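(* (1) $\mathsf{RaPar}(\mathcal C,\mathcal S)\cong\mathsf{Sect}(\mathcal C,\mathcal S)[\Phi_{\mathrm a}(\mathcal S^\circ)^{-1}]$, with localization $\Lambda\Gamma:\mathsf{Sect}(\mathcal C,\mathcal S)\to\mathsf{RaPar}(\mathcal C,\mathcal S)$. (2) If $\mathcal S$ is a class of monomorphisms, then $\mathsf{RaPar}(\mathcal C,\mathcal S)\cong\mathsf{Par}(\mathcal C,\mathcal S)\cong\mathsf{Span}(\mathcal C,\mathcal S)$.
   Context: Standing assumptions: $\mathcal C$ is a category and $\mathcal S$ is a class of morphisms of $\mathcal C$ such that pullbacks of $\mathcal S$-morphisms along arbitrary morphisms exist in $\mathcal C$ and belong to $\mathcal S$, and $\mathcal S$ belongs to an orthogonal factorization system $(\mathcal P,\mathcal S)$ of $\mathcal C$ which is relatively stable, i.e. $\mathcal P$ is stable under pullback along $\mathcal S$-morphisms. (In particular $\mathcal S$ contains all isomorphisms and is closed under composition.) For a category $\mathcal X$ and a class $\Sigma$ of its morphisms, $\mathcal X[\Sigma^{-1}]$ is the category of fractions: its localizing functor $\mathcal X\to\mathcal X[\Sigma^{-1}]$ maps $\Sigma$ to isomorphisms, and every functor on $\mathcal X$ mapping $\Sigma$ to isomorphisms factors uniquely through it. $\mathcal S$-spans: an $\mathcal S$-span $(s,f):A\to B$ is a pair $s:D\to A$ in $\mathcal S$, $f:D\to B$ in $\mathcal C$; a (vertical) morphism $x:(s,f)\to(\tilde s,\tilde f)$ is a $\mathcal C$-morphism with $\tilde s\cdot x=s$,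 $\tilde f\cdot x=f$; isomorphic spans are identified; they form the category $\mathsf{Span}(\mathcal C,\mathcal S)$ (with the objects of $\mathcal C$) under (horizontal) composition $(t,g)\cdot(s,f)=(s\cdot t',g\cdot f')$, where $f\cdot t'=t\cdot f'$ is a pullback square. A relation for $\mathcal S$-spans is compatible if it relates only $\mathcal S$-spans with the same domain and codomain, relates vertically isomorphic $\mathcal S$-spans, and is preserved by horizontal composition from either side. $\mathcal S$-cospans: an $\mathcal S$-cospan $\langle f,s\rangle:A\to B$ is (the isomorphism class of) a pair $f:A\to D$ in $\mathcal C$, $s:B\to D$ in $\mathcal S$; a morphism $v:\langle f,s\rangle\to\langle g,t\rangle$ is a $\mathcal C$-morphism with $v\cdot f=g$, $v\cdot s=t$; write $\langle f,s\rangle\preceq\langle g,t\rangle$ if there is such $v$ in $\mathcal S$. $\mathrm{pb}\langle f,s\rangle:=(s',f')$ is the $\mathcal S$-span given by the pullback square $f\cdot s'=s\cdot f'$. The conjugate of $v:\langle f,s\rangle\to\langle g,t\rangle$ is the unique $v^\star$ with $t'\cdot v^\star=s'$, $g'\cdot v^\star=f'$, where $(s',f')=\mathrm{pb}\langle f,s\rangle$, $(t',g')=\mathrm{pb}\langle g,t\rangle$. $\mathcal S^\star$ is the class of all existing pullbacks in $\mathcal C$ of conjugates $v^\star$ of $\mathcal S$-cospan morphisms $v$ with $v\in\mathcal S$; here $\mathcal S^\star\subseteq\mathcal S$. $\mathcal S^\circ$ is the least pullback-stable class $\mathcal T$ with $\mathcal S^\star\subseteq\mathcal T\subseteq\mathcal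 S$ such that for all $p,q\in\mathcal P$, $x\in\mathcal S$, $y\in\mathcal T$, $x\cdot q=p\cdot y$ implies $x\in\mathcal T$. Quotients of $\mathsf{Span}(\mathcal C,\mathcal S)$ by compatible equivalence relations: $\mathsf{Par}(\mathcal C,\mathcal S)$ by $\sim_{\mathrm z^\star}$ and $\mathsf{RaPar}(\mathcal C,\mathcal S)$ by $\sim_{\mathrm z^\circ}$, the least equivalence relations relating $(s,f)$ and $(\tilde s,\tilde f)$ whenever there is a morphism $x:(s,f)\to(\tilde s,\tilde f)$ with $x\in\mathcal S^\star$, respectively $x\in\mathcal S^\circ$; and $\mathsf{Sect}(\mathcal C,\mathcal S)$ by $\sim_{\mathrm a}$, the equivalence relation generated by the least compatible relation $\approx_{\mathrm a}$ such that $\langle f,s\rangle\preceq\langle g,t\rangle$ implies $\mathrm{pb}\langle f,s\rangle\approx_{\mathrm a}\mathrm{pb}\langle g,t\rangle$. Classes are written $[s,f]_{\mathrm z^\star}$, $[s,f]_{\mathrm z^\circ}$, $[s,f]_{\mathrm a}$. $\Phi_{\mathrm a}:\mathcal C\to\mathsf{Sect}(\mathcal C,\mathcal S)$ is $f\mapsto[1,f]_{\mathrm a}$. One has $\sim_{\mathrm a}\subseteq\sim_{\mathrm z^\star}\subseteq\sim_{\mathrm z^\circ}$, which gives the functors $\Gamma:\mathsf{Sect}(\mathcal C,\mathcal S)\to\mathsf{Par}(\mathcal C,\mathcal S)$, $[s,f]_{\mathrm a}\mapsto[s,f]_{\mathrm z^\star}$, and $\Lambda:\mathsf{Par}(\mathcal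 C,\mathcal S)\to\mathsf{RaPar}(\mathcal C,\mathcal S)$, $[s,f]_{\mathrm z^\star}\mapsto[s,f]_{\mathrm z^\circ}$. *)

theory Defs
  imports Main
begin

section \<open>Categories and functors\<close>

record ('o, 'm) cat =
  Obj :: "'o set"
  Arr :: "'m set"
  Dom :: "'m \<Rightarrow> 'o"
  Cod :: "'m \<Rightarrow> 'o"
  Ident :: "'o \<Rightarrow> 'm"
  Comp :: "'m \<Rightarrow> 'm \<Rightarrow> 'm"  (infixr "\<cdot>\<index>" 70)

locale category =
  fixes C :: "('o, 'm) cat" (structure)
  assumes Dom_in_Obj: "f \<in> Arr C \<Longrightarrow> Dom C f \<in> Obj C"
    and Cod_in_Obj: "f \<in> Arr C \<Longrightarrow> Cod C f \<in> Obj C"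
    and Ident_in_Arr: "a \<in> Obj C \<Longrightarrow> Ident C a \<in> Arr C"
    and Dom_Ident: "a \<in> Obj C \<Longrightarrow> Dom C (Ident C a) = a"
    and Cod_Ident: "a \<in> Obj C \<Longrightarrow> Cod C (Ident C a) = a"
    and Comp_in_Arr: "\<lbrakk>f \<in> Arr C; g \<in> Arr C; Cod C f = Dom C g\<rbrakk> \<Longrightarrow> g \<cdot> f \<in> Arr C"
    and Dom_Comp: "\<lbrakk>f \<in> Arr C; g \<in> Arr C; Cod C f = Dom C g\<rbrakk> \<Longrightarrow> Dom C (g \<cdot> f) = Dom C f"
    and Cod_Comp: "\<lbrakk>f \<in> Arr C; g \<in> Arr C; Cod C f = Dom C g\<rbrakk> \<Longrightarrow> Cod C (g \<cdot> f) = Cod C g"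
    and Comp_Ident_right: "f \<in> Arr C \<Longrightarrow> f \<cdot> Ident C (Dom C f) = f"
    and Comp_Ident_left: "f \<in> Arr C \<Longrightarrow> Ident C (Cod C f) \<cdot> f = f"
    and Comp_assoc: "\<lbrakk>f \<in> Arr C; g \<in> Arr C; h \<in> Arr C; Cod C f = Dom C g; Cod C g = Dom C h\<rbrakk>
          \<Longrightarrow> (h \<cdot> g) \<cdot> f = h \<cdot> (g \<cdot> f)"

definition iso :: "('o, 'm) cat \<Rightarrow> 'm \<Rightarrow> bool" where
  "iso C f \<longleftrightarrow> f \<in> Arr C \<and>
     (\<exists>g\<in>Arr C. Dom C g = Cod C f \<and> Cod C g = Dom C f \<and>
        g \<cdot>\<^bsub>C\<^esub> f = Ident C (Dom C f) \<and> f \<cdot>\<^bsub>C\<^esub> g = Ident C (Cod C f))"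

definition monic :: "('o, 'm) cat \<Rightarrow> 'm \<Rightarrow> bool" where
  "monic C f \<longleftrightarrow> f \<in> Arr C \<and>
     (\<forall>g\<in>Arr C. \<forall>h\<in>Arr C. Dom C g = Dom C h \<and> Cod C g = Dom C f \<and> Cod C h = Dom C f \<and>
        f \<cdot>\<^bsub>C\<^esub> g = f \<cdot>\<^bsub>C\<^esub> h \<longrightarrow> g = h)"

record ('o, 'm, 'p, 'q) ftor =
  OMap :: "'o \<Rightarrow> 'p"
  AMap :: "'m \<Rightarrow> 'q"

definition is_functor :: "('o, 'm) cat \<Rightarrow> ('p, 'q) cat \<Rightarrow> ('o, 'm, 'p, 'q) ftor \<Rightarrow> bool" where
  "is_functor X Y F \<longleftrightarrow> category X \<and> category Y \<and>
     (\<forall>a\<in>Obj X. OMap F a \<in> Obj Y \<and> AMap F (Ident X a) = Ident Y (OMap F a)) \<and>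
     (\<forall>f\<in>Arr X. AMap F f \<in> Arr Y \<and> Dom Y (AMap F f) = OMap F (Dom X f) \<and>
        Cod Y (AMap F f) = OMap F (Cod X f)) \<and>
     (\<forall>f\<in>Arr X. \<forall>g\<in>Arr X. Cod X f = Dom X g \<longrightarrow>
        AMap F (g \<cdot>\<^bsub>X\<^esub> f) = AMap F g \<cdot>\<^bsub>Y\<^esub> AMap F f)"

text \<open>The two maps of a functor are total, with irrelevant values off the carriers;
  hence functors are compared on the carriers only.\<close>

definition functor_eq ::
  "('o, 'm) cat \<Rightarrow> ('o, 'm, 'p, 'q) ftor \<Rightarrow> ('o, 'm, 'p, 'q) ftor \<Rightarrow> bool" where
  "functor_eq X F G \<longleftrightarrow>
     (\<forall>a\<in>Obj X. OMap F a = OMap G a) \<and> (\<forall>f\<in>Arr X. AMap F f = AMap G f)"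

definition functor_id :: "('o, 'm, 'o, 'm) ftor" where
  "functor_id = \<lparr>OMap = (\<lambda>a. a), AMap = (\<lambda>f. f)\<rparr>"

definition functor_comp ::
  "('p, 'q, 'r, 's) ftor \<Rightarrow> ('o, 'm, 'p, 'q) ftor \<Rightarrow> ('o, 'm, 'r, 's) ftor" (infixr "\<circ>\<^sub>F" 55) where
  "G \<circ>\<^sub>F F = \<lparr>OMap = OMap G \<circ> OMap F, AMap = AMap G \<circ> AMap F\<rparr>"

definition iso_functor :: "('o, 'm) cat \<Rightarrow> ('p, 'q) cat \<Rightarrow> ('o, 'm, 'p, 'q) ftor \<Rightarrow> bool" where
  "iso_functor X Y F \<longleftrightarrow> is_functor X Y F \<and>
     (\<exists>G. is_functor Y X G \<and> functor_eq X (G \<circ>\<^sub>F F) functor_id \<and> functor_eq Y (F \<circ>\<^sub>F G) functor_id)"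

definition isomorphic :: "('o, 'm) cat \<Rightarrow> ('p, 'q) cat \<Rightarrow> bool" (infix "\<cong>\<^sub>c" 50) where
  "X \<cong>\<^sub>c Y \<longleftrightarrow> (\<exists>F. iso_functor X Y F)"

text \<open>\<open>L : X \<rightarrow> Y\<close> exhibits \<open>Y\<close> as the category of fractions of \<open>X\<close> with respect to \<open>\<Sigma>\<close>.
  A definition cannot quantify over types, so the type of the test categories \<open>D\<close> is a
  parameter; a theorem with this parameter left as a type variable ranges over all of them.\<close>

definition inverts :: "('p, 'q) cat \<Rightarrow> ('o, 'm, 'p, 'q) ftor \<Rightarrow> 'm set \<Rightarrow> bool" where
  "inverts Y F \<Sigma> \<longleftrightarrow> (\<forall>f\<in>\<Sigma>. iso Y (AMap F f))"

definition is_localization ::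
  "('r, 's) cat itself \<Rightarrow> ('o, 'm) cat \<Rightarrow> 'm set \<Rightarrow> ('p, 'q) cat \<Rightarrow> ('o, 'm, 'p, 'q) ftor \<Rightarrow> bool"
  where
  "is_localization T X \<Sigma> Y L \<longleftrightarrow> \<Sigma> \<subseteq> Arr X \<and> is_functor X Y L \<and> inverts Y L \<Sigma> \<and>
     (\<forall>(D :: ('r, 's) cat) F. is_functor X D F \<and> inverts D F \<Sigma> \<longrightarrow>
        (\<exists>G. is_functor Y D G \<and> functor_eq X (G \<circ>\<^sub>F L) F \<and>
           (\<forall>G'. is_functor Y D G' \<and> functor_eq X (G' \<circ>\<^sub>F L) F \<longrightarrow> functor_eq Y G' G)))"


section \<open>Pullbacks and factorization systems\<close>

text \<open>\<open>is_pullback C f g p q\<close>: the square \<open>f \<cdot> p = g \<cdot> q\<close> is a pullback, so that \<open>p\<close> is a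
  pullback of \<open>g\<close> along \<open>f\<close>, and \<open>q\<close> is a pullback of \<open>f\<close> along \<open>g\<close>.\<close>

definition is_pullback :: "('o, 'm) cat \<Rightarrow> 'm \<Rightarrow> 'm \<Rightarrow> 'm \<Rightarrow> 'm \<Rightarrow> bool" where
  "is_pullback C f g p q \<longleftrightarrow>
     f \<in> Arr C \<and> g \<in> Arr C \<and> p \<in> Arr C \<and> q \<in> Arr C \<and>
     Cod C f = Cod C g \<and> Dom C p = Dom C q \<and> Cod C p = Dom C f \<and> Cod C q = Dom C g \<and>
     f \<cdot>\<^bsub>C\<^esub> p = g \<cdot>\<^bsub>C\<^esub> q \<and>
     (\<forall>h\<in>Arr C. \<forall>k\<in>Arr C.
        Dom C h = Dom C k \<and> Cod C h = Dom C f \<and> Cod C k = Dom C g \<and> f \<cdot>\<^bsub>C\<^esub> h = g \<cdot>\<^bsub>C\<^esub> k \<longrightarrow>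
        (\<exists>!u. u \<in> Arr C \<and> Dom C u = Dom C h \<and> Cod C u = Dom C p \<and>
              p \<cdot>\<^bsub>C\<^esub> u = h \<and> q \<cdot>\<^bsub>C\<^esub> u = k))"

definition pullback_stable :: "('o, 'm) cat \<Rightarrow> 'm set \<Rightarrow> bool" where
  "pullback_stable C T \<longleftrightarrow> (\<forall>t\<in>T. \<forall>f p q. is_pullback C f t p q \<longrightarrow> p \<in> T)"

definition orthogonal :: "('o, 'm) cat \<Rightarrow> 'm \<Rightarrow> 'm \<Rightarrow> bool" where
  "orthogonal C p s \<longleftrightarrow>
     (\<forall>u\<in>Arr C. \<forall>v\<in>Arr C.
        Dom C u = Dom C p \<and> Cod C u = Dom C s \<and> Dom C v = Cod C p \<and> Cod C v = Cod C s \<and>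
        s \<cdot>\<^bsub>C\<^esub> u = v \<cdot>\<^bsub>C\<^esub> p \<longrightarrow>
        (\<exists>!d. d \<in> Arr C \<and> Dom C d = Cod C p \<and> Cod C d = Dom C s \<and>
              d \<cdot>\<^bsub>C\<^esub> p = u \<and> s \<cdot>\<^bsub>C\<^esub> d = v))"

definition iso_closed :: "('o, 'm) cat \<Rightarrow> 'm set \<Rightarrow> bool" where
  "iso_closed C T \<longleftrightarrow> (\<forall>t\<in>T. \<forall>i. iso C i \<longrightarrow>
     (Cod C t = Dom C i \<longrightarrow> i \<cdot>\<^bsub>C\<^esub> t \<in> T) \<and> (Cod C i = Dom C t \<longrightarrow> t \<cdot>\<^bsub>C\<^esub> i \<in> T))"

definition orthogonal_factorization_system ::
  "('o, 'm) cat \<Rightarrow> 'm set \<Rightarrow> 'm set \<Rightarrow> bool" where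
  "orthogonal_factorization_system C P S \<longleftrightarrow>
     P \<subseteq> Arr C \<and> S \<subseteq> Arr C \<and> iso_closed C P \<and> iso_closed C S \<and>
     (\<forall>f\<in>Arr C. \<exists>p\<in>P. \<exists>s\<in>S. Cod C p = Dom C s \<and> f = s \<cdot>\<^bsub>C\<^esub> p) \<and>
     (\<forall>p\<in>P. \<forall>s\<in>S. orthogonal C p s)"

locale span_setting = category C for C :: "('o, 'm) cat" (structure) +
  fixes P S :: "'m set"
  assumes factorization_system: "orthogonal_factorization_system C P S"
    and pullback_exists:
      "\<lbrakk>s \<in> S; f \<in> Arr C; Cod C f = Cod C s\<rbrakk> \<Longrightarrow> \<exists>s' f'. is_pullback C f s s' f'"
    and S_pullback_stable: "pullback_stable C S"
    and P_relatively_stable: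
      "\<lbrakk>p \<in> P; s \<in> S; is_pullback C s p p' s'\<rbrakk> \<Longrightarrow> p' \<in> P"


section \<open>Spans\<close>

text \<open>A span \<open>(s, f) : A \<rightarrow> B\<close> has \<open>A = Cod C s\<close> and \<open>B = Cod C f\<close>.\<close>

type_synonym 'm span = "'m \<times> 'm"

definition spans :: "('o, 'm) cat \<Rightarrow> 'm set \<Rightarrow> 'm span set" where
  "spans C S = {(s, f). s \<in> S \<and> f \<in> Arr C \<and> Dom C s = Dom C f}"

definition vertical :: "('o, 'm) cat \<Rightarrow> 'm \<Rightarrow> 'm span \<Rightarrow> 'm span \<Rightarrow> bool" where
  "vertical C x a b \<longleftrightarrow> x \<in> Arr C \<and> Dom C x = Dom C (fst a) \<and> Cod C x = Dom C (fst b) \<and>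
     fst b \<cdot>\<^bsub>C\<^esub> x = fst a \<and> snd b \<cdot>\<^bsub>C\<^esub> x = snd a"

definition span_iso :: "('o, 'm) cat \<Rightarrow> 'm set \<Rightarrow> 'm span rel" where
  "span_iso C S = {(a, b). a \<in> spans C S \<and> b \<in> spans C S \<and> (\<exists>x. iso C x \<and> vertical C x a b)}"

text \<open>\<open>is_hcomp C b a u\<close>: the span \<open>u\<close> is a horizontal composite \<open>b \<cdot> a\<close>, for some choice of
  the pullback that defines it.\<close>

definition is_hcomp :: "('o, 'm) cat \<Rightarrow> 'm span \<Rightarrow> 'm span \<Rightarrow> 'm span \<Rightarrow> bool" where
  "is_hcomp C b a u \<longleftrightarrow>
     (\<exists>t' f'. is_pullback C (snd a) (fst b) t' f' \<and> u = (fst a \<cdot>\<^bsub>C\<^esub> t', snd b \<cdot>\<^bsub>C\<^esub> f'))"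

definition compatible :: "('o, 'm) cat \<Rightarrow> 'm set \<Rightarrow> 'm span rel \<Rightarrow> bool" where
  "compatible C S R \<longleftrightarrow>
     (\<forall>(a, b)\<in>R. a \<in> spans C S \<and> b \<in> spans C S \<and>
        Cod C (fst a) = Cod C (fst b) \<and> Cod C (snd a) = Cod C (snd b)) \<and>
     span_iso C S \<subseteq> R \<and>
     (\<forall>(a, b)\<in>R. \<forall>c\<in>spans C S. \<forall>u v.
        (is_hcomp C c a u \<and> is_hcomp C c b v \<longrightarrow> (u, v) \<in> R) \<and>
        (is_hcomp C a c u \<and> is_hcomp C b c v \<longrightarrow> (u, v) \<in> R))"

definition least_equiv :: "'a set \<Rightarrow> 'a rel \<Rightarrow> 'a rel" where
  "least_equiv A r = \<Inter>{R. equiv A R \<and> r \<subseteq> R}"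

text \<open>The quotient of the category of spans by a compatible equivalence relation \<open>R\<close>. As \<open>R\<close>
  relates isomorphic spans, an arrow is just an \<open>R\<close>-class of spans. The composite of two classes
  collects all spans related to a composite of representatives, for all choices of
  representatives and pullbacks; compatibility makes this a single class.\<close>

definition span_quotient ::
  "('o, 'm) cat \<Rightarrow> 'm set \<Rightarrow> 'm span rel \<Rightarrow> ('o, 'm span set) cat" where
  "span_quotient C S R =
     \<lparr>Obj = Obj C,
      Arr = spans C S // R,
      Dom = (\<lambda>X. THE A. \<exists>a\<in>X. A = Cod C (fst a)),
      Cod = (\<lambda>X. THE B. \<exists>a\<in>X. B = Cod C (snd a)),
      Ident = (\<lambda>A. R `` {(Ident C A, Ident C A)}),
      Comp = (\<lambda>Y X. {w. \<exists>b\<in>Y. \<exists>a\<in>X. \<exists>u. is_hcomp C b a u \<and> (u, w) \<in> R})\<rparr>"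

definition Span :: "('o, 'm) cat \<Rightarrow> 'm set \<Rightarrow> ('o, 'm span set) cat" where
  "Span C S = span_quotient C S (span_iso C S)"


section \<open>Cospans and conjugates\<close>

type_synonym 'm cospan = "'m \<times> 'm"

definition cospans :: "('o, 'm) cat \<Rightarrow> 'm set \<Rightarrow> 'm cospan set" where
  "cospans C S = {(f, s). f \<in> Arr C \<and> s \<in> S \<and> Cod C f = Cod C s}"

definition cospan_mor :: "('o, 'm) cat \<Rightarrow> 'm \<Rightarrow> 'm cospan \<Rightarrow> 'm cospan \<Rightarrow> bool" where
  "cospan_mor C v c d \<longleftrightarrow> v \<in> Arr C \<and> Dom C v = Cod C (fst c) \<and> Cod C v = Cod C (fst d) \<and>
     v \<cdot>\<^bsub>C\<^esub> fst c = fst d \<and> v \<cdot>\<^bsub>C\<^esub> snd c = snd d"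

definition cospan_le :: "('o, 'm) cat \<Rightarrow> 'm set \<Rightarrow> 'm cospan \<Rightarrow> 'm cospan \<Rightarrow> bool" where
  "cospan_le C S c d \<longleftrightarrow> (\<exists>v\<in>S. cospan_mor C v c d)"

definition is_pb :: "('o, 'm) cat \<Rightarrow> 'm cospan \<Rightarrow> 'm span \<Rightarrow> bool" where
  "is_pb C c a \<longleftrightarrow> is_pullback C (fst c) (snd c) (fst a) (snd a)"

text \<open>The two equations that characterize a conjugate of \<open>v\<close> say that it is a vertical
  morphism between the pullback spans.\<close>

definition is_conjugate ::
  "('o, 'm) cat \<Rightarrow> 'm \<Rightarrow> 'm cospan \<Rightarrow> 'm cospan \<Rightarrow> 'm \<Rightarrow> bool" where
  "is_conjugate C v c d w \<longleftrightarrow> cospan_mor C v c d \<and>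
     (\<exists>a b. is_pb C c a \<and> is_pb C d b \<and> vertical C w a b)"

definition S_star :: "('o, 'm) cat \<Rightarrow> 'm set \<Rightarrow> 'm set" where
  "S_star C S = {y. \<exists>v\<in>S. \<exists>c\<in>cospans C S. \<exists>d\<in>cospans C S. \<exists>w h k.
     is_conjugate C v c d w \<and> is_pullback C h w y k}"

definition S_circ :: "('o, 'm) cat \<Rightarrow> 'm set \<Rightarrow> 'm set \<Rightarrow> 'm set" where
  "S_circ C P S = \<Inter>{T. S_star C S \<subseteq> T \<and> T \<subseteq> S \<and> pullback_stable C T \<and>
     (\<forall>p\<in>P. \<forall>q\<in>P. \<forall>x\<in>S. \<forall>y\<in>T.
        Dom C q = Dom C y \<and> Cod C q = Dom C x \<and> Cod C y = Dom C p \<and> Cod C x = Cod C p \<and>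
        x \<cdot>\<^bsub>C\<^esub> q = p \<cdot>\<^bsub>C\<^esub> y \<longrightarrow> x \<in> T)}"


section \<open>The quotient categories\<close>

definition z_equiv :: "('o, 'm) cat \<Rightarrow> 'm set \<Rightarrow> 'm set \<Rightarrow> 'm span rel" where
  "z_equiv C S T = least_equiv (spans C S)
     {(a, b). a \<in> spans C S \<and> b \<in> spans C S \<and> (\<exists>x\<in>T. vertical C x a b)}"

definition zstar_equiv :: "('o, 'm) cat \<Rightarrow> 'm set \<Rightarrow> 'm span rel" where
  "zstar_equiv C S = z_equiv C S (S_star C S)"

definition zcirc_equiv :: "('o, 'm) cat \<Rightarrow> 'm set \<Rightarrow> 'm set \<Rightarrow> 'm span rel" where
  "zcirc_equiv C P S = z_equiv C S (S_circ C P S)"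

definition a_approx :: "('o, 'm) cat \<Rightarrow> 'm set \<Rightarrow> 'm span rel" where
  "a_approx C S = \<Inter>{R. compatible C S R \<and>
     (\<forall>c\<in>cospans C S. \<forall>d\<in>cospans C S. \<forall>a b.
        cospan_le C S c d \<and> is_pb C c a \<and> is_pb C d b \<longrightarrow> (a, b) \<in> R)}"

definition a_equiv :: "('o, 'm) cat \<Rightarrow> 'm set \<Rightarrow> 'm span rel" where
  "a_equiv C S = least_equiv (spans C S) (a_approx C S)"

definition Par :: "('o, 'm) cat \<Rightarrow> 'm set \<Rightarrow> ('o, 'm span set) cat" where
  "Par C S = span_quotient C S (zstar_equiv C S)"

definition RaPar :: "('o, 'm) cat \<Rightarrow> 'm set \<Rightarrow> 'm set \<Rightarrow> ('o, 'm span set) cat" where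
  "RaPar C P S = span_quotient C S (zcirc_equiv C P S)"

definition Sect :: "('o, 'm) cat \<Rightarrow> 'm set \<Rightarrow> ('o, 'm span set) cat" where
  "Sect C S = span_quotient C S (a_equiv C S)"

definition Phi_a :: "('o, 'm) cat \<Rightarrow> 'm set \<Rightarrow> ('o, 'm, 'o, 'm span set) ftor" where
  "Phi_a C S = \<lparr>OMap = (\<lambda>A. A), AMap = (\<lambda>f. a_equiv C S `` {(Ident C (Dom C f), f)})\<rparr>"

text \<open>For equivalence relations \<open>r \<subseteq> R\<close>, the image under \<open>R\<close> of the \<open>r\<close>-class of a span is
  the \<open>R\<close>-class of that span.\<close>

definition Gamma :: "('o, 'm) cat \<Rightarrow> 'm set \<Rightarrow> ('o, 'm span set, 'o, 'm span set) ftor" where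
  "Gamma C S = \<lparr>OMap = (\<lambda>A. A), AMap = (\<lambda>X. zstar_equiv C S `` X)\<rparr>"

definition Lambda ::
  "('o, 'm) cat \<Rightarrow> 'm set \<Rightarrow> 'm set \<Rightarrow> ('o, 'm span set, 'o, 'm span set) ftor" where
  "Lambda C P S = \<lparr>OMap = (\<lambda>A. A), AMap = (\<lambda>X. zcirc_equiv C P S `` X)\<rparr>"

end

theory Submission
  imports Defs
begin

text \<open>For \<open>x \<in> S\<close> the morphism \<open>x\<close> of cospans from \<open>\<langle>1, 1\<rangle>\<close> to \<open>\<langle>x, x\<rangle>\<close> relates the identity
  span to the kernel pair of \<open>x\<close>, so that \<open>[x, 1] \<cdot> [1, x] = 1\<close> already holds in \<open>Sect\<close>. A functor
  that inverts \<open>[1, x]\<close> therefore sends \<open>[x, x] = [1, x] \<cdot> [x, 1]\<close> to an identity. If \<open>x\<close> is a vertical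
  morphism \<open>(s, f) \<rightarrow> (s', f')\<close>, then \<open>[s, f] = [1, f'] \<cdot> [x, x] \<cdot> [s', 1]\<close>, so the functor identifies
  the two spans. This works for every pullback-stable class between \<open>S\<^sup>\<star>\<close> and \<open>S\<close>, in particular
  for \<open>S\<^sup>\<circ>\<close>. If \<open>S\<close> consists of monomorphisms, conjugates are isomorphisms, and so is every \<open>x \<in> S\<close>
  with \<open>x \<cdot> q \<in> P\<close> for some \<open>q \<in> P\<close>; hence \<open>S\<^sup>\<circ>\<close> is the class of isomorphisms.\<close>

section \<open>Calculus of composites and isomorphisms\<close>

context category
begin

declare Dom_in_Obj [simp] Cod_in_Obj [simp] Ident_in_Arr [simp] Dom_Ident [simp] Cod_Ident [simp]
  Comp_in_Arr [simp] Dom_Comp [simp] Cod_Comp [simp] Comp_assoc [simp]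

lemma Comp_Ident_right' [simp]: "\<lbrakk>f \<in> Arr C; a = Dom C f\<rbrakk> \<Longrightarrow> f \<cdot> Ident C a = f"
  and Comp_Ident_left' [simp]: "\<lbrakk>f \<in> Arr C; a = Cod C f\<rbrakk> \<Longrightarrow> Ident C a \<cdot> f = f"
  by (simp_all add: Comp_Ident_right Comp_Ident_left)

text \<open>The simplifier nests composites to the right, which hides the product
  \<open>h \<cdot> g\<close> inside \<open>h \<cdot> (g \<cdot> f)\<close>. This form makes a known
  equation for that product applicable there.\<close>

lemma Comp_assoc':
  "\<lbrakk>h \<cdot> g = k; f \<in> Arr C; g \<in> Arr C; h \<in> Arr C; Cod C f = Dom C g; Cod C g = Dom C h\<rbrakk>
    \<Longrightarrow> h \<cdot> (g \<cdot> f) = k \<cdot> f"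
  by (metis Comp_assoc)

lemma iso_Ident: "a \<in> Obj C \<Longrightarrow> iso C (Ident C a)"
  unfolding iso_def by (metis Cod_Ident Comp_Ident_left Dom_Ident Ident_in_Arr)

lemma isoE:
  assumes "iso C f"
  obtains g where "f \<in> Arr C" "g \<in> Arr C" "Dom C g = Cod C f" "Cod C g = Dom C f"
    "g \<cdot> f = Ident C (Dom C f)" "f \<cdot> g = Ident C (Cod C f)" "iso C g"
  using assms unfolding iso_def by metis

lemma iso_Comp:
  assumes "iso C f" "iso C g" "Cod C f = Dom C g"
  shows "iso C (g \<cdot> f)"
proof -
  from assms(1) obtain f' where f: "f \<in> Arr C" "f' \<in> Arr C" "Dom C f' = Cod C f" "Cod C f' = Dom C f"
    "f' \<cdot> f = Ident C (Dom C f)" "f \<cdot> f' = Ident C (Cod C f)" by (rule isoE)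
  from assms(2) obtain g' where g: "g \<in> Arr C" "g' \<in> Arr C" "Dom C g' = Cod C g" "Cod C g' = Dom C g"
    "g' \<cdot> g = Ident C (Dom C g)" "g \<cdot> g' = Ident C (Cod C g)" by (rule isoE)
  have "g' \<cdot> (g \<cdot> f) = f" "f \<cdot> (f' \<cdot> g') = g'"
    using f g assms(3) by (simp_all add: Comp_assoc'[OF g(5)] Comp_assoc'[OF f(6)])
  then show ?thesis
    unfolding iso_def using f g assms(3) by (intro conjI bexI[of _ "f' \<cdot> g'"]) simp_all
qed


section \<open>Pullbacks\<close>

lemma is_pullbackD:
  assumes "is_pullback C f g p q"
  shows "f \<in> Arr C" "g \<in> Arr C" "p \<in> Arr C" "q \<in> Arr C" "Cod C f = Cod C g" "Dom C p = Dom C q"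
    "Cod C p = Dom C f" "Cod C q = Dom C g" "f \<cdot> p = g \<cdot> q"
  using assms unfolding is_pullback_def by simp_all

lemma pullback_factor:
  assumes "is_pullback C f g p q" "h \<in> Arr C" "k \<in> Arr C" "Dom C h = Dom C k"
    "Cod C h = Dom C f" "Cod C k = Dom C g" "f \<cdot> h = g \<cdot> k"
  obtains u where "u \<in> Arr C" "Dom C u = Dom C h" "Cod C u = Dom C p" "p \<cdot> u = h" "q \<cdot> u = k"
  using assms unfolding is_pullback_def by metis

lemma pullback_unique:
  assumes "is_pullback C f g p q" "u \<in> Arr C" "v \<in> Arr C" "Dom C u = Dom C v"
    "Cod C u = Dom C p" "Cod C v = Dom C p" "p \<cdot> u = p \<cdot> v" "q \<cdot> u = q \<cdot> v"
  shows "u = v"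
proof -
  note D = is_pullbackD[OF assms(1)]
  have "\<exists>!w. w \<in> Arr C \<and> Dom C w = Dom C h \<and> Cod C w = Dom C p \<and> p \<cdot> w = h \<and> q \<cdot> w = k"
    if "h \<in> Arr C" "k \<in> Arr C" "Dom C h = Dom C k" "Cod C h = Dom C f" "Cod C k = Dom C g" "f \<cdot> h = g \<cdot> k"
    for h k
    using assms(1) that unfolding is_pullback_def by blast
  from this[of "p \<cdot> u" "q \<cdot> u"]
  have "\<exists>!w. w \<in> Arr C \<and> Dom C w = Dom C u \<and> Cod C w = Dom C p \<and> p \<cdot> w = p \<cdot> u \<and> q \<cdot> w = q \<cdot> u"
    using assms(2-6) D by (simp add: Comp_assoc'[OF D(9)])
  then show ?thesis
    using assms(2-8) by metis
qed

lemma is_pullbackI: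
  assumes "f \<in> Arr C" "g \<in> Arr C" "p \<in> Arr C" "q \<in> Arr C" "Cod C f = Cod C g" "Dom C p = Dom C q"
    "Cod C p = Dom C f" "Cod C q = Dom C g" "f \<cdot> p = g \<cdot> q"
    and factor: "\<And>h k. \<lbrakk>h \<in> Arr C; k \<in> Arr C; Dom C h = Dom C k; Cod C h = Dom C f;
      Cod C k = Dom C g; f \<cdot> h = g \<cdot> k\<rbrakk>
      \<Longrightarrow> \<exists>u. u \<in> Arr C \<and> Dom C u = Dom C h \<and> Cod C u = Dom C p \<and> p \<cdot> u = h \<and> q \<cdot> u = k"
    and unique: "\<And>u v. \<lbrakk>u \<in> Arr C; v \<in> Arr C; Dom C u = Dom C v; Cod C u = Dom C p;
      Cod C v = Dom C p; p \<cdot> u = p \<cdot> v; q \<cdot> u = q \<cdot> v\<rbrakk> \<Longrightarrow> u = v"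
  shows "is_pullback C f g p q"
  unfolding is_pullback_def
proof (intro conjI ballI impI ex_ex1I)
  fix h k
  assume "h \<in> Arr C" "k \<in> Arr C"
    "Dom C h = Dom C k \<and> Cod C h = Dom C f \<and> Cod C k = Dom C g \<and> f \<cdot> h = g \<cdot> k"
  then show "\<exists>u. u \<in> Arr C \<and> Dom C u = Dom C h \<and> Cod C u = Dom C p \<and> p \<cdot> u = h \<and> q \<cdot> u = k"
    using factor by blast
qed (fact assms(1-9) | rule unique; simp)+

lemma is_pullback_sym:
  assumes "is_pullback C f g p q"
  shows "is_pullback C g f q p"
proof -
  note D = is_pullbackD[OF assms]
  show ?thesis
  proof (rule is_pullbackI)
    fix h k
    assume hk: "h \<in> Arr C" "k \<in> Arr C" "Dom C h = Dom C k" "Cod C h = Dom C g" "Cod C k = Dom C f"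
      "g \<cdot> h = f \<cdot> k"
    obtain u where "u \<in> Arr C" "Dom C u = Dom C k" "Cod C u = Dom C p" "p \<cdot> u = k" "q \<cdot> u = h"
      using pullback_factor[OF assms hk(2,1) hk(3)[symmetric] hk(5,4) hk(6)[symmetric]] by blast
    then show "\<exists>u. u \<in> Arr C \<and> Dom C u = Dom C h \<and> Cod C u = Dom C q \<and> q \<cdot> u = h \<and> p \<cdot> u = k"
      using hk(3) D(6) by metis
  next
    fix u v
    assume "u \<in> Arr C" "v \<in> Arr C" "Dom C u = Dom C v" "Cod C u = Dom C q" "Cod C v = Dom C q"
      "q \<cdot> u = q \<cdot> v" "p \<cdot> u = p \<cdot> v"
    then show "u = v"
      using D by (auto intro: pullback_unique[OF assms])
  qed (simp_all add: D)
qed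

text \<open>A cone over the outer rectangle is lifted first through the square of \<open>f\<close>
  and \<open>g\<close>, then through the square of \<open>q\<close> and \<open>h\<close>. Uniqueness
  is cancelled in the same order.\<close>

lemma is_pullback_paste:
  assumes 1: "is_pullback C f g p q" and 2: "is_pullback C h p p' q'"
  shows "is_pullback C (f \<cdot> h) g p' (q \<cdot> q')"
proof -
  note D = is_pullbackD[OF 1] is_pullbackD[OF 2]
  have comm: "f \<cdot> (h \<cdot> p') = g \<cdot> (q \<cdot> q')"
    using D by (simp add: Comp_assoc'[OF D(9)])
  show ?thesis
  proof (rule is_pullbackI)
    fix a k
    assume a: "a \<in> Arr C" "k \<in> Arr C" "Dom C a = Dom C k" "Cod C a = Dom C (f \<cdot> h)"
      "Cod C k = Dom C g" "(f \<cdot> h) \<cdot> a = g \<cdot> k"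
    obtain u where u: "u \<in> Arr C" "Dom C u = Dom C (h \<cdot> a)" "Cod C u = Dom C p" "p \<cdot> u = h \<cdot> a"
      "q \<cdot> u = k"
      using a D by - (rule pullback_factor[OF 1, of "h \<cdot> a" k]; ((simp; fail) | blast))
    obtain w where w: "w \<in> Arr C" "Dom C w = Dom C a" "Cod C w = Dom C p'" "p' \<cdot> w = a"
      "q' \<cdot> w = u"
      using a u D by - (rule pullback_factor[OF 2, of a u]; ((simp; fail) | blast))
    show "\<exists>w. w \<in> Arr C \<and> Dom C w = Dom C a \<and> Cod C w = Dom C p' \<and> p' \<cdot> w = a \<and> (q \<cdot> q') \<cdot> w = k"
      using w u D by (intro exI[of _ w]) simp
  next
    fix u v
    assume a: "u \<in> Arr C" "v \<in> Arr C" "Dom C u = Dom C v" "Cod C u = Dom C p'"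
      "Cod C v = Dom C p'" "p' \<cdot> u = p' \<cdot> v" "(q \<cdot> q') \<cdot> u = (q \<cdot> q') \<cdot> v"
    have "h \<cdot> (p' \<cdot> u) = h \<cdot> (p' \<cdot> v)"
      using a by simp
    then have "p \<cdot> (q' \<cdot> u) = p \<cdot> (q' \<cdot> v)"
      using a(1-5) D by (simp add: Comp_assoc'[OF D(18)])
    then have "q' \<cdot> u = q' \<cdot> v"
      using a D by - (rule pullback_unique[OF 1]; simp)
    then show "u = v"
      using a D by - (rule pullback_unique[OF 2]; simp)
  qed (use D comm in simp_all)
qed

lemma is_pullback_paste':
  assumes "is_pullback C f g p q" "is_pullback C q h q' p'"
  shows "is_pullback C f (g \<cdot> h) (p \<cdot> q') p'"
  using is_pullback_paste[OF is_pullback_sym[OF assms(1)] is_pullback_sym[OF assms(2)]]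
  by (rule is_pullback_sym)

lemma is_pullback_Ident:
  "f \<in> Arr C \<Longrightarrow> is_pullback C (Ident C (Cod C f)) f f (Ident C (Dom C f))"
  by (rule is_pullbackI) auto

text \<open>The comparison map is returned together with its equations, since it has to serve later
  as an invertible vertical morphism of spans.\<close>

lemma is_pullback_iso_unique:
  assumes 1: "is_pullback C f g p q" and 2: "is_pullback C f g p' q'"
  obtains x where "iso C x" "Dom C x = Dom C p" "Cod C x = Dom C p'" "p' \<cdot> x = p" "q' \<cdot> x = q"
proof -
  note D = is_pullbackD[OF 1] is_pullbackD[OF 2]
  obtain x where x: "x \<in> Arr C" "Dom C x = Dom C p" "Cod C x = Dom C p'" "p' \<cdot> x = p" "q' \<cdot> x = q"
    using D by - (rule pullback_factor[OF 2, of p q]; ((simp; fail) | blast))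
  obtain y where y: "y \<in> Arr C" "Dom C y = Dom C p'" "Cod C y = Dom C p" "p \<cdot> y = p'" "q \<cdot> y = q'"
    using D by - (rule pullback_factor[OF 1, of p' q']; ((simp; fail) | blast))
  have "y \<cdot> x = Ident C (Dom C x)"
    using x y D Comp_assoc'[OF y(4), of x] Comp_assoc'[OF y(5), of x]
    by - (rule pullback_unique[OF 1]; simp)
  moreover have "x \<cdot> y = Ident C (Cod C x)"
    using x y D Comp_assoc'[OF x(4), of y] Comp_assoc'[OF x(5), of y]
    by - (rule pullback_unique[OF 2]; simp)
  ultimately have "iso C x"
    unfolding iso_def using x y by (intro conjI bexI[of _ y]) simp_all
  then show thesis
    using x that by blast
qed

lemma pullback_of_iso:
  assumes 1: "is_pullback C f g p q" and "iso C g"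
  shows "iso C p"
proof -
  note D = is_pullbackD[OF 1]
  from assms(2) obtain g' where g: "g' \<in> Arr C" "Dom C g' = Cod C g" "Cod C g' = Dom C g"
    "g' \<cdot> g = Ident C (Dom C g)" "g \<cdot> g' = Ident C (Cod C g)" by (rule isoE)
  have *: "g \<cdot> (g' \<cdot> f) = f" "g' \<cdot> (g \<cdot> q) = q"
    using Comp_assoc'[OF g(5), of f] Comp_assoc'[OF g(4), of q] g D by simp_all
  \<comment> \<open>The cone made of an identity and \<open>g' \<cdot> f\<close> yields a section
    \<open>r\<close> of \<open>p\<close>. It is also a left inverse because the two projections are
    jointly monic.\<close>
  obtain r where r: "r \<in> Arr C" "Dom C r = Dom C f" "Cod C r = Dom C p"
    "p \<cdot> r = Ident C (Dom C f)" "q \<cdot> r = g' \<cdot> f"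
    using * g D
    by - (rule pullback_factor[OF 1, of "Ident C (Dom C f)" "g' \<cdot> f"]; ((simp; fail) | blast))
  have "q \<cdot> (r \<cdot> p) = q"
    using Comp_assoc'[OF r(5), of p] r g D * by simp
  then have "r \<cdot> p = Ident C (Dom C p)"
    using Comp_assoc'[OF r(4), of p] r D by - (rule pullback_unique[OF 1]; simp)
  then show ?thesis
    unfolding iso_def using r D by (intro conjI bexI[of _ r]) simp_all
qed


section \<open>Orthogonality\<close>

lemma orthogonal_lift:
  assumes "orthogonal C p s" "u \<in> Arr C" "v \<in> Arr C" "Dom C u = Dom C p" "Cod C u = Dom C s"
    "Dom C v = Cod C p" "Cod C v = Cod C s" "s \<cdot> u = v \<cdot> p"
  obtains d where "d \<in> Arr C" "Dom C d = Cod C p" "Cod C d = Dom C s" "d \<cdot> p = u" "s \<cdot> d = v"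
  using assms unfolding orthogonal_def by metis

lemma orthogonal_unique:
  assumes "orthogonal C p s" "p \<in> Arr C" "s \<in> Arr C" "d \<in> Arr C" "e \<in> Arr C"
    "Dom C d = Cod C p" "Cod C d = Dom C s" "Dom C e = Cod C p" "Cod C e = Dom C s"
    "d \<cdot> p = e \<cdot> p" "s \<cdot> d = s \<cdot> e"
  shows "d = e"
proof -
  have "\<exists>!w. w \<in> Arr C \<and> Dom C w = Cod C p \<and> Cod C w = Dom C s \<and> w \<cdot> p = d \<cdot> p \<and> s \<cdot> w = s \<cdot> d"
    using assms(1-9) unfolding orthogonal_def by simp
  then show ?thesis
    using assms by metis
qed

lemma orthogonalI:
  assumes lift: "\<And>u v. \<lbrakk>u \<in> Arr C; v \<in> Arr C; Dom C u = Dom C p; Cod C u = Dom C s;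
      Dom C v = Cod C p; Cod C v = Cod C s; s \<cdot> u = v \<cdot> p\<rbrakk>
      \<Longrightarrow> \<exists>d. d \<in> Arr C \<and> Dom C d = Cod C p \<and> Cod C d = Dom C s \<and> d \<cdot> p = u \<and> s \<cdot> d = v"
    and unique: "\<And>d e. \<lbrakk>d \<in> Arr C; e \<in> Arr C; Dom C d = Cod C p; Cod C d = Dom C s;
      Dom C e = Cod C p; Cod C e = Dom C s; d \<cdot> p = e \<cdot> p; s \<cdot> d = s \<cdot> e\<rbrakk> \<Longrightarrow> d = e"
  shows "orthogonal C p s"
  unfolding orthogonal_def
proof (intro ballI impI ex_ex1I)
  fix u v
  assume "u \<in> Arr C" "v \<in> Arr C" "Dom C u = Dom C p \<and> Cod C u = Dom C s \<and> Dom C v = Cod C p \<and>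
    Cod C v = Cod C s \<and> s \<cdot> u = v \<cdot> p"
  then show "\<exists>d. d \<in> Arr C \<and> Dom C d = Cod C p \<and> Cod C d = Dom C s \<and> d \<cdot> p = u \<and> s \<cdot> d = v"
    using lift by blast
qed (rule unique; simp)

lemma orthogonal_Ident:
  assumes "p \<in> Arr C" "a \<in> Obj C"
  shows "orthogonal C p (Ident C a)"
  by (rule orthogonalI) (use assms in auto)

text \<open>A square against \<open>s \<cdot> t\<close> is filled in two stages: the diagonal
  \<open>e\<close> for \<open>s\<close> becomes the lower edge of a square against
  \<open>t\<close>.\<close>

lemma orthogonal_Comp:
  assumes st: "orthogonal C p s" "orthogonal C p t" and D: "p \<in> Arr C" "s \<in> Arr C" "t \<in> Arr C" "Cod C t = Dom C s"
  shows "orthogonal C p (s \<cdot> t)"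
proof (rule orthogonalI)
  fix u v
  assume a: "u \<in> Arr C" "v \<in> Arr C" "Dom C u = Dom C p" "Cod C u = Dom C (s \<cdot> t)"
    "Dom C v = Cod C p" "Cod C v = Cod C (s \<cdot> t)" "(s \<cdot> t) \<cdot> u = v \<cdot> p"
  obtain e where e: "e \<in> Arr C" "Dom C e = Cod C p" "Cod C e = Dom C s" "e \<cdot> p = t \<cdot> u" "s \<cdot> e = v"
    using a D by - (rule orthogonal_lift[OF st(1), of "t \<cdot> u" v]; ((simp; fail) | blast))
  obtain d where d: "d \<in> Arr C" "Dom C d = Cod C p" "Cod C d = Dom C t" "d \<cdot> p = u" "t \<cdot> d = e"
    using a e D by - (rule orthogonal_lift[OF st(2), of u e]; ((simp; fail) | blast))
  show "\<exists>d. d \<in> Arr C \<and> Dom C d = Cod C p \<and> Cod C d = Dom C (s \<cdot> t) \<and> d \<cdot> p = u \<and> (s \<cdot> t) \<cdot> d = v"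
    using d e D by (intro exI[of _ d]) simp
next
  fix d e
  assume a: "d \<in> Arr C" "e \<in> Arr C" "Dom C d = Cod C p" "Cod C d = Dom C (s \<cdot> t)"
    "Dom C e = Cod C p" "Cod C e = Dom C (s \<cdot> t)" "d \<cdot> p = e \<cdot> p" "(s \<cdot> t) \<cdot> d = (s \<cdot> t) \<cdot> e"
  have "t \<cdot> d = t \<cdot> e"
    using a D by - (rule orthogonal_unique[OF st(1)]; simp)
  then show "d = e"
    using a D by - (rule orthogonal_unique[OF st(2)]; simp)
qed

text \<open>The square against \<open>t\<close> is extended by \<open>s\<close> and filled for
  \<open>s \<cdot> t\<close>. The lower triangle then commutes before composing with
  \<open>s\<close>, because \<open>t \<cdot> d\<close> and \<open>v\<close> both fill one square
  against \<open>s\<close>.\<close>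

lemma orthogonal_cancel:
  assumes st: "orthogonal C p s" "orthogonal C p (s \<cdot> t)"
    and D: "p \<in> Arr C" "s \<in> Arr C" "t \<in> Arr C" "Cod C t = Dom C s"
  shows "orthogonal C p t"
proof (rule orthogonalI)
  fix u v
  assume a: "u \<in> Arr C" "v \<in> Arr C" "Dom C u = Dom C p" "Cod C u = Dom C t"
    "Dom C v = Cod C p" "Cod C v = Cod C t" "t \<cdot> u = v \<cdot> p"
  obtain d where d: "d \<in> Arr C" "Dom C d = Cod C p" "Cod C d = Dom C (s \<cdot> t)" "d \<cdot> p = u"
    "(s \<cdot> t) \<cdot> d = s \<cdot> v"
    using a D by - (rule orthogonal_lift[OF st(2), of u "s \<cdot> v"]; ((simp; fail) | blast))
  have "t \<cdot> d = v"
    using a d D by - (rule orthogonal_unique[OF st(1)]; simp)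
  with d D show "\<exists>d. d \<in> Arr C \<and> Dom C d = Cod C p \<and> Cod C d = Dom C t \<and> d \<cdot> p = u \<and> t \<cdot> d = v"
    by (intro exI[of _ d]) simp
next
  fix d e
  assume a: "d \<in> Arr C" "e \<in> Arr C" "Dom C d = Cod C p" "Cod C d = Dom C t"
    "Dom C e = Cod C p" "Cod C e = Dom C t" "d \<cdot> p = e \<cdot> p" "t \<cdot> d = t \<cdot> e"
  then show "d = e"
    using D by - (rule orthogonal_unique[OF st(2)]; simp)
qed

end

section \<open>Closure properties of the right class of a factorization system\<close>

context span_setting
begin

lemma P_Arr: "p \<in> P \<Longrightarrow> p \<in> Arr C"
  and S_Arr: "s \<in> S \<Longrightarrow> s \<in> Arr C"
  and PS_orthogonal: "\<lbrakk>p \<in> P; s \<in> S\<rbrakk> \<Longrightarrow> orthogonal C p s"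
  and P_comp_iso: "\<lbrakk>p \<in> P; iso C i; Cod C i = Dom C p\<rbrakk> \<Longrightarrow> p \<cdot> i \<in> P"
  and S_comp_iso: "\<lbrakk>s \<in> S; iso C i; Cod C i = Dom C s\<rbrakk> \<Longrightarrow> s \<cdot> i \<in> S"
  using factorization_system
  unfolding orthogonal_factorization_system_def iso_closed_def by blast+

lemma factorization:
  assumes "f \<in> Arr C"
  obtains p s where "p \<in> P" "s \<in> S" "Cod C p = Dom C s" "f = s \<cdot> p"
  using assms factorization_system unfolding orthogonal_factorization_system_def by blast

text \<open>Retract argument: in a factorization \<open>f = s \<cdot> p\<close>, lifting
  \<open>p\<close> against \<open>f\<close> produces an inverse of \<open>p\<close>, so
  \<open>f\<close> differs from \<open>s\<close> by an isomorphism. Identities, composition and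
  cancellation for \<open>S\<close> thereby reduce to orthogonality.\<close>

lemma right_orthogonal_in_S:
  assumes f: "f \<in> Arr C" "\<And>p. p \<in> P \<Longrightarrow> orthogonal C p f"
  shows "f \<in> S"
proof -
  obtain p s where ps: "p \<in> P" "s \<in> S" "Cod C p = Dom C s" "f = s \<cdot> p"
    using factorization[OF f(1)] by blast
  note D = P_Arr[OF ps(1)] S_Arr[OF ps(2)]
  obtain d where d: "d \<in> Arr C" "Dom C d = Cod C p" "Cod C d = Dom C f"
    "d \<cdot> p = Ident C (Dom C f)" "f \<cdot> d = s"
    using ps D f(1)
    by - (rule orthogonal_lift[OF f(2)[OF ps(1)], of "Ident C (Dom C f)" s]; ((simp; fail) | blast))
  \<comment> \<open>Both sides are diagonals of the same square with left edge \<open>p\<close> and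
    right edge \<open>s\<close>.\<close>
  have "p \<cdot> d = Ident C (Cod C p)"
    using ps D d by - (rule orthogonal_unique[OF PS_orthogonal[OF ps(1,2)]]; simp)
  then have "iso C p"
    unfolding iso_def using ps D d by (intro conjI bexI[of _ d]) simp_all
  then show ?thesis
    using ps S_comp_iso by simp
qed

lemma Ident_S: "a \<in> Obj C \<Longrightarrow> Ident C a \<in> S"
  by (intro right_orthogonal_in_S orthogonal_Ident) (simp_all add: P_Arr)

lemma iso_S:
  assumes "iso C i"
  shows "i \<in> S"
proof -
  have "i \<in> Arr C" using assms by (rule isoE)
  then show ?thesis
    using S_comp_iso[OF Ident_S assms, of "Cod C i"] by simp
qed

lemma S_Comp: "\<lbrakk>s \<in> S; t \<in> S; Cod C t = Dom C s\<rbrakk> \<Longrightarrow> s \<cdot> t \<in> S"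
  by (intro right_orthogonal_in_S orthogonal_Comp) (simp_all add: P_Arr S_Arr PS_orthogonal)

lemma S_cancel:
  assumes "s \<in> S" "s \<cdot> t \<in> S" "t \<in> Arr C" "Cod C t = Dom C s"
  shows "t \<in> S"
  by (rule right_orthogonal_in_S[OF assms(3)], rule orthogonal_cancel[of _ s])
     (use assms in \<open>simp_all add: P_Arr S_Arr PS_orthogonal\<close>)

lemma S_pullback: "\<lbrakk>is_pullback C f s p q; s \<in> S\<rbrakk> \<Longrightarrow> p \<in> S"
  using S_pullback_stable unfolding pullback_stable_def by blast

text \<open>Lifting \<open>x \<cdot> q\<close> against \<open>x\<close> gives a section
  \<open>d\<close> of \<open>x\<close>, and orthogonality of \<open>q\<close> and \<open>x\<close>
  forces \<open>d \<cdot> x\<close> to be an identity. In the monic case this is what keeps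
  \<open>S_circ\<close> within the isomorphisms.\<close>

lemma iso_if_S_Comp_P:
  assumes "x \<in> S" "q \<in> P" "x \<cdot> q \<in> P" "Cod C q = Dom C x"
  shows "iso C x"
proof -
  note D = S_Arr[OF assms(1)] P_Arr[OF assms(2)] P_Arr[OF assms(3)] assms(4)
  obtain d where d: "d \<in> Arr C" "Dom C d = Cod C (x \<cdot> q)" "Cod C d = Dom C x"
    "d \<cdot> (x \<cdot> q) = q" "x \<cdot> d = Ident C (Cod C x)"
    using D by - (rule orthogonal_lift[OF PS_orthogonal[OF assms(3,1)],
        of q "Ident C (Cod C x)"]; ((simp; fail) | blast))
  have "d \<cdot> x = Ident C (Dom C x)"
    using D d Comp_assoc'[OF d(5), of x]
    by - (rule orthogonal_unique[OF PS_orthogonal[OF assms(2,1)]]; simp)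
  then show ?thesis
    unfolding iso_def using D d by (intro conjI bexI[of _ d]) simp_all
qed

end

section \<open>Composition of spans\<close>

lemma least_equiv_least: "\<lbrakk>equiv A R; r \<subseteq> R\<rbrakk> \<Longrightarrow> least_equiv A r \<subseteq> R"
  unfolding least_equiv_def by blast

lemma least_equiv_extensive: "r \<subseteq> least_equiv A r"
  unfolding least_equiv_def by blast

text \<open>The bound \<open>r \<subseteq> A \<times> A\<close> makes \<open>A \<times> A\<close>
  itself a member of the intersected family, so the intersection stays inside
  \<open>A \<times> A\<close>.\<close>

lemma equiv_least_equiv:
  assumes "r \<subseteq> A \<times> A"
  shows "equiv A (least_equiv A r)"
proof (rule equivI)
  have "equiv A (A \<times> A)"
    by (auto intro!: equivI refl_onI symI transI)
  then show "least_equiv A r \<subseteq> A \<times> A"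
    by (rule least_equiv_least) fact
  show "refl_on A (least_equiv A r)"
    by (auto simp: least_equiv_def equiv_def refl_on_def)
  show "sym (least_equiv A r)"
    by (auto simp: least_equiv_def equiv_def intro!: symI dest: symD)
  show "trans (least_equiv A r)"
  proof (rule transI)
    fix x y z
    assume xyz: "(x, y) \<in> least_equiv A r" "(y, z) \<in> least_equiv A r"
    have "(x, z) \<in> R" if "equiv A R" "r \<subseteq> R" for R
    proof -
      have "(x, y) \<in> R" "(y, z) \<in> R"
        using xyz that least_equiv_least by blast+
      then show ?thesis
        using that(1) unfolding equiv_def by (blast dest: transD)
    qed
    then show "(x, z) \<in> least_equiv A r"
      by (simp add: least_equiv_def)
  qed
qed

section \<open>Spans up to isomorphism and their horizontal composites\<close>

context span_setting
begin

lemma spans_iff: "a \<in> spans C S \<longleftrightarrow> fst a \<in> S \<and> snd a \<in> Arr C \<and> Dom C (fst a) = Dom C (snd a)"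
  unfolding spans_def by auto

lemma spansD:
  assumes "a \<in> spans C S"
  shows "fst a \<in> S" "fst a \<in> Arr C" "snd a \<in> Arr C" "Dom C (fst a) = Dom C (snd a)"
  using assms S_Arr by (auto simp: spans_iff)

lemma vertical_cod:
  assumes "vertical C x a b" "b \<in> spans C S"
  shows "Cod C (fst a) = Cod C (fst b)" "Cod C (snd a) = Cod C (snd b)"
  using assms spansD[OF assms(2)] Cod_Comp[of x "fst b"] Cod_Comp[of x "snd b"]
  unfolding vertical_def by auto

lemma span_isoI:
  "\<lbrakk>a \<in> spans C S; b \<in> spans C S; iso C x; vertical C x a b\<rbrakk> \<Longrightarrow> (a, b) \<in> span_iso C S"
  unfolding span_iso_def by auto

lemma vertical_Ident: "a \<in> spans C S \<Longrightarrow> vertical C (Ident C (Dom C (fst a))) a a"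
  using spansD[of a] unfolding vertical_def by simp

lemma equiv_span_iso: "equiv (spans C S) (span_iso C S)"
proof (rule equivI)
  show "span_iso C S \<subseteq> spans C S \<times> spans C S"
    unfolding span_iso_def by auto
  show "refl_on (spans C S) (span_iso C S)"
    using spansD(2) by (auto intro!: refl_onI span_isoI[OF _ _ iso_Ident vertical_Ident])
  show "sym (span_iso C S)"
  proof (rule symI)
    fix a b
    assume "(a, b) \<in> span_iso C S"
    then obtain x where x: "a \<in> spans C S" "b \<in> spans C S" "iso C x" "vertical C x a b"
      unfolding span_iso_def by auto
    note D = spansD[OF x(1)] spansD[OF x(2)] x(4)[unfolded vertical_def]
    obtain y where y: "x \<in> Arr C" "y \<in> Arr C" "Dom C y = Cod C x" "Cod C y = Dom C x"
      "x \<cdot> y = Ident C (Cod C x)" "iso C y"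
      using isoE[OF x(3)] by metis
    have "fst a \<cdot> y = fst b" "snd a \<cdot> y = snd b"
      using D y Comp_assoc[of y x "fst b"] Comp_assoc[of y x "snd b"] by auto
    then have "vertical C y b a"
      unfolding vertical_def using D y by auto
    then show "(b, a) \<in> span_iso C S"
      using x y by (auto intro: span_isoI)
  qed
  show "trans (span_iso C S)"
  proof (rule transI)
    fix a b c
    assume "(a, b) \<in> span_iso C S" "(b, c) \<in> span_iso C S"
    then obtain x y where x: "a \<in> spans C S" "b \<in> spans C S" "c \<in> spans C S" "iso C x"
      "vertical C x a b" "iso C y" "vertical C y b c"
      unfolding span_iso_def by auto
    note D = spansD[OF x(1)] spansD[OF x(2)] spansD[OF x(3)] x(5,7)[unfolded vertical_def]
    have "fst c \<cdot> (y \<cdot> x) = fst a" "snd c \<cdot> (y \<cdot> x) = snd a"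
      using D Comp_assoc'[of "fst c" y "fst b" x] Comp_assoc'[of "snd c" y "snd b" x] by simp_all
    then have "vertical C (y \<cdot> x) a c"
      unfolding vertical_def using D by simp
    then show "(a, c) \<in> span_iso C S"
      using x D iso_Comp[of x y] by (intro span_isoI) auto
  qed
qed

lemma hcomp_ex:
  assumes "a \<in> spans C S" "b \<in> spans C S" "Cod C (snd a) = Cod C (fst b)"
  shows "\<exists>u. is_hcomp C b a u"
  using pullback_exists[of "fst b" "snd a"] assms spansD unfolding is_hcomp_def by blast

lemma hcompD:
  assumes "is_hcomp C b a u" and ab: "a \<in> spans C S" "b \<in> spans C S"
  shows "u \<in> spans C S" "Cod C (fst u) = Cod C (fst a)" "Cod C (snd u) = Cod C (snd b)"
    "Cod C (snd a) = Cod C (fst b)"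
proof -
  obtain t f where tf: "is_pullback C (snd a) (fst b) t f" "u = (fst a \<cdot> t, snd b \<cdot> f)"
    using assms(1) unfolding is_hcomp_def by blast
  note D = is_pullbackD[OF tf(1)] spansD[OF ab(1)] spansD[OF ab(2)]
  have "t \<in> S"
    using S_pullback[OF tf(1)] D by simp
  then have "fst a \<cdot> t \<in> S"
    using D by (intro S_Comp) simp_all
  then show "u \<in> spans C S" "Cod C (fst u) = Cod C (fst a)" "Cod C (snd u) = Cod C (snd b)"
    "Cod C (snd a) = Cod C (fst b)"
    using D unfolding tf(2) spans_iff by simp_all
qed

text \<open>Two choices of the defining pullback differ by an invertible comparison map, which is
  vertical between the resulting spans.\<close>

lemma hcomp_iso_unique:
  assumes u: "is_hcomp C b a u" and v: "is_hcomp C b a v" and ab: "a \<in> spans C S" "b \<in> spans C S"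
  shows "(u, v) \<in> span_iso C S"
proof -
  obtain t f where tf: "is_pullback C (snd a) (fst b) t f" "u = (fst a \<cdot> t, snd b \<cdot> f)"
    using u unfolding is_hcomp_def by blast
  obtain t' f' where tf': "is_pullback C (snd a) (fst b) t' f'" "v = (fst a \<cdot> t', snd b \<cdot> f')"
    using v unfolding is_hcomp_def by blast
  note D = is_pullbackD[OF tf(1)] is_pullbackD[OF tf'(1)] spansD[OF ab(1)] spansD[OF ab(2)]
  obtain x where x: "iso C x" "Dom C x = Dom C t" "Cod C x = Dom C t'" "t' \<cdot> x = t" "f' \<cdot> x = f"
    using is_pullback_iso_unique[OF tf(1) tf'(1)] by blast
  have "x \<in> Arr C"
    using x(1) by (rule isoE)
  then have "vertical C x u v"
    unfolding vertical_def tf(2) tf'(2) using D x by simp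
  then show ?thesis
    using x(1) hcompD(1)[OF u ab] hcompD(1)[OF v ab] by (intro span_isoI)
qed

text \<open>One representative serves both bracketings: a third pullback on top of the two defining
  ones computes either triple composite by pasting. Associativity is thus strict for suitable
  choices.\<close>

lemma hcomp_assoc:
  assumes a: "a \<in> spans C S" and b: "b \<in> spans C S" and c: "c \<in> spans C S"
    and cod: "Cod C (snd a) = Cod C (fst b)" "Cod C (snd b) = Cod C (fst c)"
  obtains u v w where "is_hcomp C b a u" "is_hcomp C c b v" "is_hcomp C c u w" "is_hcomp C v a w"
proof -
  note D = spansD[OF a] spansD[OF b] spansD[OF c]
  obtain t1 f1 where 1: "is_pullback C (snd a) (fst b) t1 f1"
    using pullback_exists[of "fst b" "snd a"] D cod by blast
  obtain t2 f2 where 2: "is_pullback C (snd b) (fst c) t2 f2"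
    using pullback_exists[of "fst c" "snd b"] D cod by blast
  note D1 = is_pullbackD[OF 1] and D2 = is_pullbackD[OF 2]
  \<comment> \<open>This pullback exists because \<open>t2\<close>, a pullback of the left leg of
    \<open>c\<close>, lies in \<open>S\<close>.\<close>
  obtain t3 f3 where 3: "is_pullback C f1 t2 t3 f3"
    using pullback_exists[of t2 f1] S_pullback[OF 2 D(9)] D1 D2 D(8) by auto
  note D3 = is_pullbackD[OF 3]
  have *: "fst a \<cdot> t1 \<cdot> t3 = (fst a \<cdot> t1) \<cdot> t3" "snd c \<cdot> f2 \<cdot> f3 = (snd c \<cdot> f2) \<cdot> f3"
    using D D1 D2 D3 by simp_all
  show thesis
  proof (rule that)
    show "is_hcomp C b a (fst a \<cdot> t1, snd b \<cdot> f1)" "is_hcomp C c b (fst b \<cdot> t2, snd c \<cdot> f2)"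
      using 1 2 unfolding is_hcomp_def by blast+
    show "is_hcomp C c (fst a \<cdot> t1, snd b \<cdot> f1) (fst a \<cdot> t1 \<cdot> t3, snd c \<cdot> f2 \<cdot> f3)"
      using is_pullback_paste[OF 2 3] *(1) unfolding is_hcomp_def fst_conv snd_conv by metis
    show "is_hcomp C (fst b \<cdot> t2, snd c \<cdot> f2) a (fst a \<cdot> t1 \<cdot> t3, snd c \<cdot> f2 \<cdot> f3)"
      using is_pullback_paste'[OF 1 3] *(2) unfolding is_hcomp_def fst_conv snd_conv by metis
  qed
qed

lemma hcomp_Ident_right:
  assumes "a \<in> spans C S" "A = Cod C (fst a)"
  shows "is_hcomp C a (Ident C A, Ident C A) a"
  using is_pullback_Ident[of "fst a"] assms spansD[OF assms(1)] unfolding is_hcomp_def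
  by (intro exI[of _ "fst a"] exI[of _ "Ident C (Dom C (fst a))"]) simp

lemma hcomp_Ident_left:
  assumes "a \<in> spans C S" "B = Cod C (snd a)"
  shows "is_hcomp C (Ident C B, Ident C B) a a"
  using is_pullback_sym[OF is_pullback_Ident[of "snd a"]] assms spansD[OF assms(1)] unfolding is_hcomp_def
  by (intro exI[of _ "snd a"] exI[of _ "Ident C (Dom C (snd a))"]) simp

lemma Ident_span: "A \<in> Obj C \<Longrightarrow> (Ident C A, Ident C A) \<in> spans C S"
  unfolding spans_iff using Ident_S by simp

lemma Ident_arr_span: "f \<in> Arr C \<Longrightarrow> (Ident C (Dom C f), f) \<in> spans C S"
  unfolding spans_iff using Ident_S by simp

lemma arr_Ident_span: "x \<in> S \<Longrightarrow> (x, Ident C (Dom C x)) \<in> spans C S"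
  unfolding spans_iff using S_Arr by simp

lemma arr_arr_span: "x \<in> S \<Longrightarrow> (x, x) \<in> spans C S"
  unfolding spans_iff using S_Arr by simp

text \<open>Pulling \<open>x\<close> back along \<open>t\<close> and pasting onto the square that
  defines \<open>v\<close> gives a composite of \<open>a\<close> with \<open>c\<close>. The
  projection \<open>y\<close> opposite to \<open>x\<close> is the required vertical
  morphism.\<close>

lemma hcomp_vertical_right:
  assumes T: "pullback_stable C T" "x \<in> T" and x: "vertical C x a b"
    and b: "b \<in> spans C S" and c: "c \<in> spans C S" and v: "is_hcomp C c b v"
  obtains u y where "is_hcomp C c a u" "y \<in> T" "vertical C y u v"
proof -
  obtain t f where tf: "is_pullback C (snd b) (fst c) t f" "v = (fst b \<cdot> t, snd c \<cdot> f)"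
    using v unfolding is_hcomp_def by blast
  note D = spansD[OF b] spansD[OF c] is_pullbackD[OF tf(1)] x[unfolded vertical_def]
  obtain t' y where y: "is_pullback C x t t' y"
    using pullback_exists[of t x] S_pullback[OF tf(1)] D by auto
  note Dy = is_pullbackD[OF y]
  show thesis
  proof (rule that)
    show "is_hcomp C c a (fst a \<cdot> t', snd c \<cdot> f \<cdot> y)"
      using is_pullback_paste[OF tf(1) y] D unfolding is_hcomp_def by auto
    show "y \<in> T"
      using T is_pullback_sym[OF y] unfolding pullback_stable_def by blast
    have "fst a \<cdot> t' = fst b \<cdot> x \<cdot> t'"
      using D Dy Comp_assoc[of t' x "fst b"] by simp
    then show "vertical C y (fst a \<cdot> t', snd c \<cdot> f \<cdot> y) v"
      unfolding vertical_def tf(2) using D Dy by simp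
  qed
qed

text \<open>Here \<open>x\<close> is pulled back along the other projection \<open>f\<close> of the
  square that defines \<open>v\<close>. The inclusion of \<open>T\<close> in \<open>S\<close>
  guarantees that this pullback exists.\<close>

lemma hcomp_vertical_left:
  assumes T: "pullback_stable C T" "x \<in> T" "T \<subseteq> S" and x: "vertical C x a b"
    and b: "b \<in> spans C S" and c: "c \<in> spans C S" and v: "is_hcomp C b c v"
  obtains u y where "is_hcomp C a c u" "y \<in> T" "vertical C y u v"
proof -
  obtain t f where tf: "is_pullback C (snd c) (fst b) t f" "v = (fst c \<cdot> t, snd b \<cdot> f)"
    using v unfolding is_hcomp_def by blast
  note D = spansD[OF b] spansD[OF c] is_pullbackD[OF tf(1)] x[unfolded vertical_def]
  obtain y f' where y: "is_pullback C f x y f'"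
    using pullback_exists[of x f] T(2,3) D by auto
  note Dy = is_pullbackD[OF y]
  show thesis
  proof (rule that)
    show "is_hcomp C a c (fst c \<cdot> t \<cdot> y, snd a \<cdot> f')"
      using is_pullback_paste'[OF tf(1) y] D unfolding is_hcomp_def by auto
    show "y \<in> T"
      using T y unfolding pullback_stable_def by blast
    have "snd a \<cdot> f' = snd b \<cdot> x \<cdot> f'"
      using D Dy Comp_assoc[of f' x "snd b"] by simp
    then show "vertical C y (fst c \<cdot> t \<cdot> y, snd a \<cdot> f') v"
      unfolding vertical_def tf(2) using D Dy by simp
  qed
qed

section \<open>Compatibility checked on generators\<close>

definition parallel :: "('m span \<times> 'm span) set" where
  "parallel = {(a, b). a \<in> spans C S \<and> b \<in> spans C S \<and>
     Cod C (fst a) = Cod C (fst b) \<and> Cod C (snd a) = Cod C (snd b)}"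

text \<open>Two arguments allow the composites of pairs from a generating relation \<open>r\<close>
  to be compared in the larger relation \<open>R\<close>; compatibility itself uses the case
  \<open>r = R\<close>.\<close>

definition hcomp_closed :: "('m span \<times> 'm span) set \<Rightarrow> ('m span \<times> 'm span) set \<Rightarrow> bool" where
  "hcomp_closed r R \<longleftrightarrow> (\<forall>(a, b)\<in>r. \<forall>c\<in>spans C S. \<forall>u v.
     (is_hcomp C c a u \<and> is_hcomp C c b v \<longrightarrow> (u, v) \<in> R) \<and>
     (is_hcomp C a c u \<and> is_hcomp C b c v \<longrightarrow> (u, v) \<in> R))"

lemma compatible_iff:
  "compatible C S R \<longleftrightarrow> R \<subseteq> parallel \<and> span_iso C S \<subseteq> R \<and> hcomp_closed R R"
  unfolding compatible_def parallel_def hcomp_closed_def by auto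

lemma equiv_parallel: "equiv (spans C S) parallel"
  unfolding parallel_def by (auto intro!: equivI refl_onI symI transI)

text \<open>The pairs of \<open>R\<close> all of whose composites stay in \<open>R\<close> form an
  equivalence relation containing \<open>r\<close>, hence are all of \<open>R\<close>. Its
  reflexivity is independence of the chosen pullbacks, where
  \<open>span_iso C S \<subseteq> R\<close> enters.\<close>

lemma compatible_least_equiv:
  fixes r
  defines "R \<equiv> least_equiv (spans C S) r"
  assumes r: "r \<subseteq> parallel" and iso: "span_iso C S \<subseteq> R" and closed: "hcomp_closed r R"
  shows "compatible C S R"
proof -
  let ?Q = "{(a, b) \<in> R. hcomp_closed {(a, b)} R}"
  have R: "equiv (spans C S) R"
    unfolding R_def by (rule equiv_least_equiv) (use r in \<open>auto simp: parallel_def\<close>)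
  have par: "R \<subseteq> parallel"
    unfolding R_def by (rule least_equiv_least[OF equiv_parallel r])
  have sub: "R \<subseteq> spans C S \<times> spans C S"
    using par by (auto simp: parallel_def)
  have "equiv (spans C S) ?Q"
  proof (rule equivI)
    show "?Q \<subseteq> spans C S \<times> spans C S"
      using sub by auto
    show "refl_on (spans C S) ?Q"
    proof (rule refl_onI)
      fix a
      assume "a \<in> spans C S"
      then show "(a, a) \<in> ?Q"
        using R iso hcomp_iso_unique unfolding hcomp_closed_def equiv_def refl_on_def by blast
    qed
    show "sym ?Q"
      using R unfolding hcomp_closed_def equiv_def sym_def by blast
    show "trans ?Q"
    proof (rule transI)
      fix a b c
      assume ab: "(a, b) \<in> ?Q" and bc: "(b, c) \<in> ?Q"
      then have abc: "(a, b) \<in> R" "(b, c) \<in> R" "(a, b) \<in> parallel" "(b, c) \<in> parallel"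
        using par by auto
      have tr: "(u, w) \<in> R" if "(u, v) \<in> R" "(v, w) \<in> R" for u v w
        using R that unfolding equiv_def trans_def by blast
      have "(u, v) \<in> R" if d: "d \<in> spans C S" "is_hcomp C d a u" "is_hcomp C d c v" for d u v
      proof -
        \<comment> \<open>Transitivity passes through a composite with the middle span
          \<open>b\<close>. It exists because related spans are parallel and pullbacks of
          \<open>S\<close>-morphisms exist.\<close>
        have "Cod C (snd b) = Cod C (fst d)"
          using hcompD(4)[OF d(2)] d(1) abc(3) unfolding parallel_def by auto
        then obtain w where "is_hcomp C d b w"
          using hcomp_ex[of b d] d(1) abc(4) unfolding parallel_def by auto
        then show ?thesis
          using d ab bc tr[of u w v] unfolding hcomp_closed_def by blast
      qed
      moreover have "(u, v) \<in> R" if d: "d \<in> spans C S" "is_hcomp C a d u" "is_hcomp C c d v" for d u v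
      proof -
        have "Cod C (snd d) = Cod C (fst b)"
          using hcompD(4)[OF d(2)] d(1) abc(3) unfolding parallel_def by auto
        then obtain w where "is_hcomp C b d w"
          using hcomp_ex[of d b] d(1) abc(4) unfolding parallel_def by auto
        then show ?thesis
          using d ab bc tr[of u w v] unfolding hcomp_closed_def by blast
      qed
      ultimately show "(a, c) \<in> ?Q"
        using tr[OF abc(1,2)] unfolding hcomp_closed_def by blast
    qed
  qed
  moreover have "r \<subseteq> ?Q"
    using closed least_equiv_extensive[of r "spans C S"] unfolding R_def hcomp_closed_def by blast
  ultimately have "R \<subseteq> ?Q"
    unfolding R_def by (rule least_equiv_least)
  then have "hcomp_closed R R"
    unfolding hcomp_closed_def by blast
  then show ?thesis
    using par iso compatible_iff by blast
qed

end


section \<open>Quotients of the category of spans\<close>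

text \<open>Instantiated below at \<open>a_equiv C S\<close> and at \<open>z_equiv C S T\<close>, so
  that one construction handles \<open>Sect\<close>, \<open>Par\<close> and
  \<open>RaPar\<close>.\<close>

locale span_congruence = span_setting +
  fixes R :: "'b span rel"
  assumes equiv: "equiv (spans C S) R" and compatible: "compatible C S R"
begin

abbreviation cls :: "'b span \<Rightarrow> 'b span set" where
  "cls a \<equiv> R `` {a}"

abbreviation Quot :: "('a, 'b span set) cat" where
  "Quot \<equiv> span_quotient C S R"

lemma cls_eq_iff: "\<lbrakk>a \<in> spans C S; b \<in> spans C S\<rbrakk> \<Longrightarrow> cls a = cls b \<longleftrightarrow> (a, b) \<in> R"
  using eq_equiv_class_iff[OF equiv] by simp

lemma cls_self: "a \<in> spans C S \<Longrightarrow> a \<in> cls a"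
  using equiv_class_self[OF equiv] .

lemma R_parallel: "(a, b) \<in> R \<Longrightarrow> (a, b) \<in> parallel"
  using compatible compatible_iff by blast

lemma R_trans: "(a, b) \<in> R \<Longrightarrow> (b, c) \<in> R \<Longrightarrow> (a, c) \<in> R"
  using equiv unfolding equiv_def trans_def by blast

text \<open>Compatibility changes only one factor at a time, so the comparison passes through a
  composite of \<open>b\<close> with \<open>a'\<close>.\<close>

lemma hcomp_R:
  assumes "(a, a') \<in> R" "(b, b') \<in> R" "is_hcomp C b a u" "is_hcomp C b' a' v"
  shows "(u, v) \<in> R"
proof -
  have S: "a \<in> spans C S" "a' \<in> spans C S" "b \<in> spans C S" "b' \<in> spans C S"
    and "Cod C (snd a) = Cod C (snd a')"
    using R_parallel[OF assms(1)] R_parallel[OF assms(2)] unfolding parallel_def by auto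
  then obtain w where w: "is_hcomp C b a' w"
    using hcomp_ex[of a' b] hcompD(4)[OF assms(3)] by auto
  have closed: "hcomp_closed R R"
    using compatible compatible_iff by blast
  have "(u, w) \<in> R"
    using closed assms(1,3) w S unfolding hcomp_closed_def by blast
  moreover have "(w, v) \<in> R"
    using closed assms(2,4) w S unfolding hcomp_closed_def by blast
  ultimately show ?thesis
    by (rule R_trans)
qed

lemma Quot_Obj [simp]: "Obj Quot = Obj C"
  and Quot_Ident [simp]: "Ident Quot A = cls (Ident C A, Ident C A)"
  by (simp_all add: span_quotient_def)

lemma cls_Arr [simp]: "a \<in> spans C S \<Longrightarrow> cls a \<in> Arr Quot"
  by (simp add: span_quotient_def quotientI)

lemma Quot_ArrE:
  assumes "X \<in> Arr Quot"
  obtains a where "a \<in> spans C S" "X = cls a"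
  using assms by (auto simp: span_quotient_def elim: quotientE)

lemma cls_cod:
  assumes "b \<in> cls a"
  shows "Cod C (fst b) = Cod C (fst a)" "Cod C (snd b) = Cod C (snd a)"
  using R_parallel[of a b] assms unfolding parallel_def by auto

lemma Quot_Dom [simp]:
  assumes "a \<in> spans C S"
  shows "Dom Quot (cls a) = Cod C (fst a)"
  unfolding span_quotient_def cat.simps
  using cls_cod(1) cls_self[OF assms] by (intro the_equality) blast+

lemma Quot_Cod [simp]:
  assumes "a \<in> spans C S"
  shows "Cod Quot (cls a) = Cod C (snd a)"
  unfolding span_quotient_def cat.simps
  using cls_cod(2) cls_self[OF assms] by (intro the_equality) blast+

lemma Quot_Comp:
  assumes "a \<in> spans C S" "b \<in> spans C S" "is_hcomp C b a u"
  shows "cls b \<cdot>\<^bsub>Quot\<^esub> cls a = cls u"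
proof -
  have "(u, w) \<in> R" if "(a, a') \<in> R" "(b, b') \<in> R" "is_hcomp C b' a' v" "(v, w) \<in> R" for a' b' v w
    using hcomp_R[OF that(1,2) assms(3) that(3)] that(4) R_trans by blast
  then show ?thesis
    using cls_self[OF assms(1)] cls_self[OF assms(2)] assms(3) by (auto simp: span_quotient_def)
qed

lemma category_Quot: "category Quot"
proof
  fix X
  assume "X \<in> Arr Quot"
  then obtain a where a: "a \<in> spans C S" "X = cls a"
    by (rule Quot_ArrE)
  then show "Dom Quot X \<in> Obj Quot" "Cod Quot X \<in> Obj Quot"
    using spansD[OF a(1)] by simp_all
  show "X \<cdot>\<^bsub>Quot\<^esub> Ident Quot (Dom Quot X) = X"
    using a Ident_span hcomp_Ident_right[OF a(1) refl] spansD[OF a(1)] by (simp add: Quot_Comp)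
  show "Ident Quot (Cod Quot X) \<cdot>\<^bsub>Quot\<^esub> X = X"
    using a Ident_span hcomp_Ident_left[OF a(1) refl] spansD[OF a(1)] by (simp add: Quot_Comp)
next
  fix A
  assume "A \<in> Obj Quot"
  then show "Ident Quot A \<in> Arr Quot" "Dom Quot (Ident Quot A) = A" "Cod Quot (Ident Quot A) = A"
    using Ident_span[of A] by simp_all
next
  fix X Y
  assume "X \<in> Arr Quot" "Y \<in> Arr Quot" and cod: "Cod Quot X = Dom Quot Y"
  then obtain a b where ab: "a \<in> spans C S" "X = cls a" "b \<in> spans C S" "Y = cls b"
    by (metis Quot_ArrE)
  with cod obtain u where u: "is_hcomp C b a u"
    using hcomp_ex[of a b] by auto
  note D = hcompD[OF u ab(1,3)]
  have "Y \<cdot>\<^bsub>Quot\<^esub> X = cls u"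
    using Quot_Comp[OF ab(1,3) u] ab by simp
  then show "Y \<cdot>\<^bsub>Quot\<^esub> X \<in> Arr Quot" "Dom Quot (Y \<cdot>\<^bsub>Quot\<^esub> X) = Dom Quot X"
    "Cod Quot (Y \<cdot>\<^bsub>Quot\<^esub> X) = Cod Quot Y"
    using D ab by simp_all
next
  fix X Y Z
  assume "X \<in> Arr Quot" "Y \<in> Arr Quot" "Z \<in> Arr Quot"
    and cod: "Cod Quot X = Dom Quot Y" "Cod Quot Y = Dom Quot Z"
  then obtain a b c where abc: "a \<in> spans C S" "b \<in> spans C S" "c \<in> spans C S"
    "X = cls a" "Y = cls b" "Z = cls c"
    by (metis Quot_ArrE)
  with cod obtain u v w where u: "is_hcomp C b a u" "is_hcomp C c b v" "is_hcomp C c u w" "is_hcomp C v a w"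
    using hcomp_assoc[OF abc(1-3)] by (metis Quot_Cod Quot_Dom)
  have "u \<in> spans C S" "v \<in> spans C S"
    using hcompD(1) u abc by blast+
  then show "(Z \<cdot>\<^bsub>Quot\<^esub> Y) \<cdot>\<^bsub>Quot\<^esub> X = Z \<cdot>\<^bsub>Quot\<^esub> (Y \<cdot>\<^bsub>Quot\<^esub> X)"
    using abc u by (simp add: Quot_Comp)
qed

end

section \<open>The compatible equivalence relations\<close>

context span_setting
begin

text \<open>Presents an isomorphism as a pullback of an identity, the form in which isomorphisms
  enter \<open>S_star\<close>.\<close>

lemma is_pullback_iso_iso:
  assumes "iso C i"
  shows "is_pullback C (Ident C (Cod C i)) (Ident C (Cod C i)) i i"
proof -
  obtain j where j: "i \<in> Arr C" "j \<in> Arr C" "Dom C j = Cod C i" "Cod C j = Dom C i"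
    "j \<cdot> i = Ident C (Dom C i)" "i \<cdot> j = Ident C (Cod C i)"
    using isoE[OF assms] by metis
  show ?thesis
  proof (rule is_pullbackI)
    fix h k
    assume "h \<in> Arr C" "k \<in> Arr C" "Dom C h = Dom C k" "Cod C h = Dom C (Ident C (Cod C i))"
      "Cod C k = Dom C (Ident C (Cod C i))" "Ident C (Cod C i) \<cdot> h = Ident C (Cod C i) \<cdot> k"
    then show "\<exists>u. u \<in> Arr C \<and> Dom C u = Dom C h \<and> Cod C u = Dom C i \<and> i \<cdot> u = h \<and> i \<cdot> u = k"
      using j Comp_assoc'[OF j(6), of h] by (intro exI[of _ "j \<cdot> h"]) simp
  next
    fix u v
    assume uv: "u \<in> Arr C" "v \<in> Arr C" "Dom C u = Dom C v" "Cod C u = Dom C i" "Cod C v = Dom C i"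
      "i \<cdot> u = i \<cdot> v"
    then have "j \<cdot> (i \<cdot> u) = j \<cdot> (i \<cdot> v)"
      by simp
    then show "u = v"
      using uv(1-5) j by (simp add: Comp_assoc'[OF j(5)])
  qed (use j in simp_all)
qed

lemma is_pb_Ident:
  assumes "a \<in> Obj C"
  shows "is_pb C (Ident C a, Ident C a) (Ident C a, Ident C a)"
  using is_pullback_Ident[of "Ident C a"] assms unfolding is_pb_def by simp

lemma Ident_cospan: "a \<in> Obj C \<Longrightarrow> (Ident C a, Ident C a) \<in> cospans C S"
  unfolding cospans_def using Ident_S by simp

section \<open>The classes \<open>S_star\<close> and \<open>S_circ\<close>\<close>

lemma conjugate_S_star:
  assumes "v \<in> S" "c \<in> cospans C S" "d \<in> cospans C S" and w: "is_conjugate C v c d w"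
  shows "w \<in> S_star C S"
proof -
  have "w \<in> Arr C"
    using w unfolding is_conjugate_def vertical_def by blast
  then show ?thesis
    using assms is_pullback_Ident[of w] unfolding S_star_def by blast
qed

text \<open>The identity morphism of the identity cospan is its own conjugate, and \<open>i\<close>
  is a pullback of it.\<close>

lemma iso_S_star:
  assumes i: "iso C i"
  shows "i \<in> S_star C S"
proof -
  let ?A = "Cod C i" and ?I = "Ident C (Cod C i)"
  have A: "?A \<in> Obj C"
    using i by (auto elim: isoE)
  have "is_conjugate C ?I (?I, ?I) (?I, ?I) ?I"
    unfolding is_conjugate_def cospan_mor_def using is_pb_Ident[OF A] A
    by (intro conjI exI) (auto simp: vertical_def)
  then show ?thesis
    unfolding S_star_def using is_pullback_iso_iso[OF i] Ident_S[OF A] Ident_cospan[OF A] by blast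
qed

lemma S_star_pullback_stable: "pullback_stable C (S_star C S)"
  unfolding pullback_stable_def S_star_def using is_pullback_paste by blast

text \<open>A conjugate \<open>w\<close> satisfies \<open>fst b \<cdot> w = fst a\<close> with both
  left legs in \<open>S\<close>, so cancellation puts \<open>w\<close> in \<open>S\<close>; pullback
  stability passes this on to \<open>y\<close>.\<close>

lemma S_star_subset: "S_star C S \<subseteq> S"
proof
  fix y
  assume "y \<in> S_star C S"
  then obtain v c d w h k where y: "d \<in> cospans C S" "c \<in> cospans C S" "is_conjugate C v c d w"
    "is_pullback C h w y k"
    unfolding S_star_def by blast
  then obtain a b where ab: "is_pullback C (fst c) (snd c) (fst a) (snd a)"
    "is_pullback C (fst d) (snd d) (fst b) (snd b)" "vertical C w a b"
    unfolding is_conjugate_def is_pb_def by blast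
  have "fst a \<in> S" "fst b \<in> S"
    using S_pullback[OF ab(1)] S_pullback[OF ab(2)] y(1,2) unfolding cospans_def by auto
  then have "w \<in> S"
    using ab(3) S_cancel[of "fst b" w] unfolding vertical_def by auto
  then show "y \<in> S"
    using S_pullback[OF y(4)] by blast
qed

lemma S_star_subset_S_circ: "S_star C S \<subseteq> S_circ C P S"
  unfolding S_circ_def by blast

lemma S_circ_subset: "S_circ C P S \<subseteq> S"
  unfolding S_circ_def using S_star_subset S_pullback_stable by (intro Inter_lower) auto

lemma S_circ_pullback_stable: "pullback_stable C (S_circ C P S)"
  unfolding S_circ_def pullback_stable_def by blast

section \<open>The relations generated by vertical morphisms, and their comparison with
  \<open>a_equiv\<close>\<close>

lemma vertical_z_equiv:
  "\<lbrakk>a \<in> spans C S; b \<in> spans C S; x \<in> T; vertical C x a b\<rbrakk> \<Longrightarrow> (a, b) \<in> z_equiv C S T"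
  unfolding z_equiv_def by (rule subsetD[OF least_equiv_extensive]) auto

lemma z_equiv_least:
  assumes "equiv (spans C S) R"
    and "\<And>a b x. \<lbrakk>a \<in> spans C S; b \<in> spans C S; x \<in> T; vertical C x a b\<rbrakk> \<Longrightarrow> (a, b) \<in> R"
  shows "z_equiv C S T \<subseteq> R"
  unfolding z_equiv_def using assms by (intro least_equiv_least) auto

lemma equiv_z_equiv: "equiv (spans C S) (z_equiv C S T)"
  unfolding z_equiv_def by (rule equiv_least_equiv) auto

lemma z_equiv_mono: "T \<subseteq> U \<Longrightarrow> z_equiv C S T \<subseteq> z_equiv C S U"
  by (rule z_equiv_least[OF equiv_z_equiv]) (blast intro: vertical_z_equiv)

text \<open>Composing with a span on either side turns a vertical morphism in \<open>T\<close> into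
  another one, by pullback stability. Arbitrary choices of the composites differ from the
  constructed ones by isomorphisms, which lie in \<open>S_star C S\<close> and so in
  \<open>T\<close>.\<close>

lemma span_congruence_z_equiv:
  assumes T: "S_star C S \<subseteq> T" "T \<subseteq> S" "pullback_stable C T"
  shows "span_congruence C P S (z_equiv C S T)"
proof
  let ?R = "z_equiv C S T" and ?r = "{(a, b). a \<in> spans C S \<and> b \<in> spans C S \<and> (\<exists>x\<in>T. vertical C x a b)}"
  show "equiv (spans C S) ?R"
    by (rule equiv_z_equiv)
  have trans: "(a, c) \<in> ?R" if "(a, b) \<in> ?R" "(b, c) \<in> ?R" for a b c
    using equiv_z_equiv[of T] that unfolding equiv_def trans_def by blast
  have iso: "span_iso C S \<subseteq> ?R"
    using T(1) iso_S_star unfolding span_iso_def by (auto intro: vertical_z_equiv)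
  have closed: "(u, v) \<in> ?R"
    if u: "u \<in> spans C S" and v: "v \<in> spans C S" and u': "(u, u') \<in> span_iso C S"
      and y: "y \<in> T" "vertical C y u' v" for u u' v y
  proof (rule trans)
    show "(u, u') \<in> ?R"
      using iso u' by blast
    show "(u', v) \<in> ?R"
      using u' v y unfolding span_iso_def by (auto intro: vertical_z_equiv)
  qed
  have "hcomp_closed ?r ?R"
    unfolding hcomp_closed_def
  proof (clarify, intro conjI impI; elim conjE)
    fix s f s' f' t g u1 u2 v1 v2 x
    assume S: "(s, f) \<in> spans C S" "(s', f') \<in> spans C S" "(t, g) \<in> spans C S"
      and x: "x \<in> T" "vertical C x (s, f) (s', f')"
    show "((u1, u2), (v1, v2)) \<in> ?R"
      if uv: "is_hcomp C (t, g) (s, f) (u1, u2)" "is_hcomp C (t, g) (s', f') (v1, v2)"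
      using hcomp_vertical_right[OF T(3) x S(2,3) uv(2)] hcomp_iso_unique[OF uv(1) _ S(1,3)]
        hcompD(1)[OF uv(1) S(1,3)] hcompD(1)[OF uv(2) S(2,3)] closed by metis
    show "((u1, u2), (v1, v2)) \<in> ?R"
      if uv: "is_hcomp C (s, f) (t, g) (u1, u2)" "is_hcomp C (s', f') (t, g) (v1, v2)"
      using hcomp_vertical_left[OF T(3) x(1) T(2) x(2) S(2,3) uv(2)] hcomp_iso_unique[OF uv(1) _ S(3,1)]
        hcompD(1)[OF uv(1) S(3,1)] hcompD(1)[OF uv(2) S(3,2)] closed by metis
  qed
  moreover have "?r \<subseteq> parallel"
    unfolding parallel_def using vertical_cod by blast
  ultimately show "compatible C S ?R"
    using iso unfolding z_equiv_def by (intro compatible_least_equiv)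
qed

text \<open>Composing the pullback square of \<open>c\<close> with \<open>v\<close> gives a cone
  over \<open>d\<close>. The induced vertical morphism is a conjugate of \<open>v\<close>, hence in
  \<open>S_star\<close>.\<close>

lemma pb_zstar:
  assumes cd: "c \<in> cospans C S" "d \<in> cospans C S" "cospan_le C S c d" and ab: "is_pb C c a" "is_pb C d b"
  shows "(a, b) \<in> z_equiv C S (S_star C S)"
proof -
  obtain v where v: "v \<in> S" "cospan_mor C v c d"
    using cd(3) unfolding cospan_le_def by blast
  have ab': "is_pullback C (fst c) (snd c) (fst a) (snd a)" "is_pullback C (fst d) (snd d) (fst b) (snd b)"
    using ab unfolding is_pb_def by auto
  have s: "snd c \<in> S" "snd d \<in> S"
    using cd unfolding cospans_def by auto
  note Da = is_pullbackD[OF ab'(1)] and Db = is_pullbackD[OF ab'(2)]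
  have *: "v \<in> Arr C" "Dom C v = Cod C (fst c)" "Cod C v = Cod C (fst d)" "v \<cdot> fst c = fst d" "v \<cdot> snd c = snd d"
    using v(2) unfolding cospan_mor_def by auto
  have dom: "Dom C (fst d) = Dom C (fst c)" "Dom C (snd d) = Dom C (snd c)"
    using *(1,2) Da Dom_Comp[of "fst c" v] Dom_Comp[of "snd c" v] unfolding *(4,5) by auto
  have "fst d \<cdot> fst a = v \<cdot> (fst c \<cdot> fst a)" "snd d \<cdot> snd a = v \<cdot> (snd c \<cdot> snd a)"
    using * Da Comp_assoc'[OF *(4), of "fst a"] Comp_assoc'[OF *(5), of "snd a"] by auto
  then have "fst d \<cdot> fst a = snd d \<cdot> snd a"
    using Da(9) by metis
  then obtain w where "w \<in> Arr C" "Dom C w = Dom C (fst a)" "Cod C w = Dom C (fst b)"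
    "fst b \<cdot> w = fst a" "snd b \<cdot> w = snd a"
    using pullback_factor[OF ab'(2) Da(3,4,6)] Da(7,8) dom by metis
  then have w: "vertical C w a b"
    unfolding vertical_def by simp
  have "w \<in> S_star C S"
    using v ab w cd by (intro conjugate_S_star[of v c d]) (simp_all only: is_conjugate_def, blast)
  moreover have "a \<in> spans C S" "b \<in> spans C S"
    unfolding spans_iff using S_pullback[OF ab'(1) s(1)] S_pullback[OF ab'(2) s(2)] Da Db by simp_all
  ultimately show ?thesis
    using w by (auto intro: vertical_z_equiv)
qed

lemmas span_congruence_zstar =
  span_congruence_z_equiv[OF order_refl S_star_subset S_star_pullback_stable]

lemma a_approx_subset_zstar: "a_approx C S \<subseteq> z_equiv C S (S_star C S)"
  unfolding a_approx_def
  using pb_zstar span_congruence.compatible[OF span_congruence_zstar] by (intro Inter_lower) blast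

text \<open>Compatibility passes to intersections. That related spans are parallel also needs some
  member in the intersected family, and the relation generated by \<open>S_star\<close> is
  one.\<close>

lemma compatible_a_approx: "compatible C S (a_approx C S)"
proof -
  have "a_approx C S \<subseteq> parallel"
    using a_approx_subset_zstar span_congruence.compatible[OF span_congruence_zstar]
    unfolding compatible_iff by blast
  moreover have "span_iso C S \<subseteq> a_approx C S"
    unfolding a_approx_def compatible_iff by blast
  moreover have "hcomp_closed (a_approx C S) (a_approx C S)"
    unfolding hcomp_closed_def
  proof (intro ballI allI, clarify)
    fix s f s' f' t g u1 u2 v1 v2
    assume ab: "((s, f), (s', f')) \<in> a_approx C S" and c: "(t, g) \<in> spans C S"
    have "((u1, u2), (v1, v2)) \<in> R"
      if "hcomp_closed R R" "((s, f), (s', f')) \<in> R"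
        "is_hcomp C (t, g) (s, f) (u1, u2) \<and> is_hcomp C (t, g) (s', f') (v1, v2) \<or>
         is_hcomp C (s, f) (t, g) (u1, u2) \<and> is_hcomp C (s', f') (t, g) (v1, v2)" for R
      using that c unfolding hcomp_closed_def by blast
    then show "(is_hcomp C (t, g) (s, f) (u1, u2) \<and> is_hcomp C (t, g) (s', f') (v1, v2) \<longrightarrow>
        ((u1, u2), (v1, v2)) \<in> a_approx C S) \<and>
      (is_hcomp C (s, f) (t, g) (u1, u2) \<and> is_hcomp C (s', f') (t, g) (v1, v2) \<longrightarrow>
        ((u1, u2), (v1, v2)) \<in> a_approx C S)"
      using ab unfolding a_approx_def compatible_iff by blast
  qed
  ultimately show ?thesis
    unfolding compatible_iff by blast
qed

lemma a_approx_subset: "a_approx C S \<subseteq> a_equiv C S"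
  unfolding a_equiv_def by (rule least_equiv_extensive)

lemma span_congruence_a_equiv: "span_congruence C P S (a_equiv C S)"
proof
  have r: "a_approx C S \<subseteq> parallel" "span_iso C S \<subseteq> a_approx C S"
    "hcomp_closed (a_approx C S) (a_approx C S)"
    using compatible_a_approx unfolding compatible_iff by auto
  show "equiv (spans C S) (a_equiv C S)"
    unfolding a_equiv_def by (rule equiv_least_equiv) (use r(1) in \<open>auto simp: parallel_def\<close>)
  have "hcomp_closed (a_approx C S) (a_equiv C S)"
    using r(3) a_approx_subset unfolding hcomp_closed_def by blast
  then show "compatible C S (a_equiv C S)"
    using r(1,2) a_approx_subset unfolding a_equiv_def by (intro compatible_least_equiv) auto
qed

lemma a_equiv_subset_z_equiv:
  assumes "S_star C S \<subseteq> T"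
  shows "a_equiv C S \<subseteq> z_equiv C S T"
  unfolding a_equiv_def
  using a_approx_subset_zstar z_equiv_mono[OF assms] by (intro least_equiv_least equiv_z_equiv) blast

lemma kernel_pair_a_equiv:
  assumes x: "x \<in> S" and pq: "is_pullback C x x p q"
  shows "((Ident C (Dom C x), Ident C (Dom C x)), (p, q)) \<in> a_equiv C S"
proof -
  let ?I = "Ident C (Dom C x)"
  note D = S_Arr[OF x]
  have "cospan_le C S (?I, ?I) (x, x)"
    unfolding cospan_le_def cospan_mor_def using x D by (intro bexI[of _ x]) auto
  moreover have "is_pb C (?I, ?I) (?I, ?I)" "is_pb C (x, x) (p, q)"
    using is_pb_Ident[of "Dom C x"] D pq by (auto simp: is_pb_def)
  moreover have "(?I, ?I) \<in> cospans C S" "(x, x) \<in> cospans C S"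
    using Ident_cospan x D by (auto simp: cospans_def)
  ultimately have "((?I, ?I), (p, q)) \<in> a_approx C S"
    unfolding a_approx_def by blast
  then show ?thesis
    using a_approx_subset by blast
qed

end


section \<open>Localization\<close>

text \<open>The formula does not mention the finer relation of the source, so it covers
  \<open>Gamma\<close>, \<open>Lambda\<close> and their composite alike.\<close>

definition quotient_functor :: "'m span rel \<Rightarrow> ('o, 'm span set, 'o, 'm span set) ftor" where
  "quotient_functor R = \<lparr>OMap = (\<lambda>A. A), AMap = (\<lambda>X. R `` X)\<rparr>"

lemma (in span_congruence) Image_cls:
  assumes "equiv (spans C S) R'" "R \<subseteq> R'" "a \<in> spans C S"
  shows "R' `` cls a = R' `` {a}"
  using assms cls_self[OF assms(3)] unfolding equiv_def trans_def by blast

context span_setting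
begin

text \<open>Both quotients compute a composite from the same span \<open>u\<close>, so passing to
  the coarser class respects composition.\<close>

lemma is_functor_quotient:
  assumes "span_congruence C P S R" "span_congruence C P S R'" "R \<subseteq> R'"
  shows "is_functor (span_quotient C S R) (span_quotient C S R') (quotient_functor R')"
proof -
  interpret R: span_congruence C P S R by fact
  interpret R': span_congruence C P S R' by fact
  note cls = R.Image_cls[OF R'.equiv assms(3)]
  have AMap: "AMap (quotient_functor R') (R.cls a) = R'.cls a" if "a \<in> spans C S" for a
    using cls[OF that] by (simp add: quotient_functor_def)
  have OMap: "OMap (quotient_functor R') A = A" for A
    by (simp add: quotient_functor_def)
  show ?thesis
    unfolding is_functor_def
  proof (intro conjI ballI impI)
    fix X
    assume "X \<in> Arr R.Quot"
    then show "AMap (quotient_functor R') X \<in> Arr R'.Quot"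
      "Dom R'.Quot (AMap (quotient_functor R') X) = OMap (quotient_functor R') (Dom R.Quot X)"
      "Cod R'.Quot (AMap (quotient_functor R') X) = OMap (quotient_functor R') (Cod R.Quot X)"
      by (auto elim!: R.Quot_ArrE simp: AMap OMap)
  next
    fix X Y
    assume XY: "X \<in> Arr R.Quot" "Y \<in> Arr R.Quot" "Cod R.Quot X = Dom R.Quot Y"
    then obtain a b where ab: "a \<in> spans C S" "b \<in> spans C S" "X = R.cls a" "Y = R.cls b"
      by (metis R.Quot_ArrE)
    then obtain u where u: "is_hcomp C b a u"
      using XY hcomp_ex[of a b] by auto
    then show "AMap (quotient_functor R') (Y \<cdot>\<^bsub>R.Quot\<^esub> X) =
        AMap (quotient_functor R') Y \<cdot>\<^bsub>R'.Quot\<^esub> AMap (quotient_functor R') X"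
      using ab hcompD(1)[OF u ab(1,2)] by (simp add: AMap R.Quot_Comp R'.Quot_Comp)
  qed (use R.category_Quot R'.category_Quot Ident_span in \<open>simp_all add: AMap OMap\<close>)
qed

end

section \<open>Spans factored through \<open>(x, x)\<close>\<close>

context span_congruence
begin

lemma cls_retract_left:
  assumes "x \<in> S"
  shows "cls (Ident C (Dom C x), x) \<cdot>\<^bsub>Quot\<^esub> cls (x, Ident C (Dom C x)) = cls (x, x)"
proof (rule Quot_Comp[OF arr_Ident_span Ident_arr_span])
  show "is_hcomp C (Ident C (Dom C x), x) (x, Ident C (Dom C x)) (x, x)"
    unfolding is_hcomp_def
    using is_pullback_Ident[of "Ident C (Dom C x)"] S_Arr[OF assms]
    by (intro exI[of _ "Ident C (Dom C x)"]) simp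
qed (use assms S_Arr in auto)

text \<open>The composite is the kernel pair of \<open>x\<close>. It need not be an identity span,
  but \<open>a_equiv\<close> relates it to one, so the equation holds in every quotient by a
  relation \<open>R\<close> containing \<open>a_equiv\<close>.\<close>

lemma cls_retract_right:
  assumes "a_equiv C S \<subseteq> R" and x: "x \<in> S"
  shows "cls (x, Ident C (Dom C x)) \<cdot>\<^bsub>Quot\<^esub> cls (Ident C (Dom C x), x) = Ident Quot (Dom C x)"
proof -
  note D = S_Arr[OF x]
  obtain p q where pq: "is_pullback C x x p q"
    using pullback_exists[of x x] x D by auto
  note Dp = is_pullbackD[OF pq]
  have h: "is_hcomp C (x, Ident C (Dom C x)) (Ident C (Dom C x), x) (p, q)"
    unfolding is_hcomp_def using pq Dp by (intro exI[of _ p] exI[of _ q]) simp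
  have pqS: "(p, q) \<in> spans C S"
    using hcompD(1)[OF h Ident_arr_span[OF D] arr_Ident_span[OF x]] .
  have "cls (Ident C (Dom C x), Ident C (Dom C x)) = cls (p, q)"
    using kernel_pair_a_equiv[OF x pq] assms(1) D pqS cls_eq_iff Ident_span by auto
  then show ?thesis
    using Quot_Comp[OF Ident_arr_span[OF D] arr_Ident_span[OF x] h] by simp
qed

text \<open>The vertical equations say that \<open>a\<close> is
  \<open>(fst b \<cdot> x, snd b \<cdot> x)\<close>, and both composites need only pullbacks along
  identities. Just the middle factor depends on \<open>x\<close>.\<close>

lemma cls_factor:
  assumes x: "x \<in> S" "vertical C x a b" and a: "a \<in> spans C S" and b: "b \<in> spans C S"
  shows "cls a = cls (Ident C (Dom C (snd b)), snd b) \<cdot>\<^bsub>Quot\<^esub>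
    (cls (x, x) \<cdot>\<^bsub>Quot\<^esub> cls (fst b, Ident C (Dom C (fst b))))"
proof -
  note D = spansD[OF b] S_Arr[OF x(1)] x(2)[unfolded vertical_def]
  let ?I = "Ident C (Dom C (fst b))"
  have b1: "(fst b, ?I) \<in> spans C S"
    using arr_Ident_span D(1) .
  have h1: "is_hcomp C (x, x) (fst b, ?I) (fst b \<cdot> x, x \<cdot> Ident C (Dom C x))"
    unfolding is_hcomp_def using is_pullback_Ident[of x] D
    by (intro exI[of _ x] exI[of _ "Ident C (Dom C x)"]) simp
  have xb: "(fst b \<cdot> x, x) \<in> spans C S"
    using hcompD(1)[OF h1 b1 arr_arr_span[OF x(1)]] D(5) by simp
  have "is_hcomp C (Ident C (Dom C (snd b)), snd b) (fst b \<cdot> x, x)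
     ((fst b \<cdot> x) \<cdot> Ident C (Dom C x), snd b \<cdot> x)"
    unfolding is_hcomp_def using is_pullback_sym[OF is_pullback_Ident[of x]] D
    by (intro exI[of _ "Ident C (Dom C x)"] exI[of _ x]) simp
  then have h2: "is_hcomp C (Ident C (Dom C (snd b)), snd b) (fst b \<cdot> x, x) a"
    using D spansD[OF a] by simp
  show ?thesis
    using Quot_Comp[OF b1 arr_arr_span[OF x(1)] h1] Quot_Comp[OF xb Ident_arr_span[OF D(3)] h2] D(5)
    by simp
qed

end

text \<open>Turns a one-sided inverse that is already at hand into a two-sided one, by comparing it
  with any inverse.\<close>

lemma (in category) iso_left_inverse:
  assumes "iso C f" "g \<in> Arr C" "Dom C g = Cod C f" "g \<cdot> f = Ident C (Dom C f)"
  shows "f \<cdot> g = Ident C (Cod C f)"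
proof -
  obtain h where h: "f \<in> Arr C" "h \<in> Arr C" "Dom C h = Cod C f" "Cod C h = Dom C f"
    "f \<cdot> h = Ident C (Cod C f)"
    using isoE[OF assms(1)] by metis
  have "g \<cdot> (f \<cdot> h) = h"
    using Comp_assoc'[OF assms(4), of h] h assms(2,3) by (simp del: Comp_assoc)
  then have "g = h"
    using h assms(2,3) by simp
  then show ?thesis
    using h by simp
qed

lemma functorD:
  assumes "is_functor X Y F"
  shows "category X" "category Y"
    "\<And>a. a \<in> Obj X \<Longrightarrow> OMap F a \<in> Obj Y"
    "\<And>a. a \<in> Obj X \<Longrightarrow> AMap F (Ident X a) = Ident Y (OMap F a)"
    "\<And>f. f \<in> Arr X \<Longrightarrow> AMap F f \<in> Arr Y"
    "\<And>f. f \<in> Arr X \<Longrightarrow> Dom Y (AMap F f) = OMap F (Dom X f)"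
    "\<And>f. f \<in> Arr X \<Longrightarrow> Cod Y (AMap F f) = OMap F (Cod X f)"
    "\<And>f g. \<lbrakk>f \<in> Arr X; g \<in> Arr X; Cod X f = Dom X g\<rbrakk>
      \<Longrightarrow> AMap F (g \<cdot>\<^bsub>X\<^esub> f) = AMap F g \<cdot>\<^bsub>Y\<^esub> AMap F f"
  using assms unfolding is_functor_def by blast+

lemma is_functor_id: "category X \<Longrightarrow> is_functor X X functor_id"
  unfolding is_functor_def functor_id_def by simp

lemma is_functor_comp:
  assumes F: "is_functor X Y F" and G: "is_functor Y Z G"
  shows "is_functor X Z (G \<circ>\<^sub>F F)"
  unfolding is_functor_def functor_comp_def
  using functorD[OF F] functorD[OF G] by simp

context span_setting
begin

lemma functor_vertical_eq:
  assumes F: "is_functor (Sect C S) D F" and inv: "inverts D F (AMap (Phi_a C S) ` T)"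
    and x: "x \<in> T" "T \<subseteq> S" "vertical C x a b" and a: "a \<in> spans C S" and b: "b \<in> spans C S"
  shows "AMap F (a_equiv C S `` {a}) = AMap F (a_equiv C S `` {b})"
proof -
  interpret A: span_congruence C P S "a_equiv C S"
    by (rule span_congruence_a_equiv)
  interpret D: category D
    by (rule functorD(2)[OF F])
  note F' = functorD[OF F[unfolded Sect_def]]
  let ?dx = "Ident C (Dom C x)" and ?db = "Ident C (Dom C (fst b))"
  have xS: "x \<in> S" and xA: "x \<in> Arr C" and Sb: "fst b \<in> S" "fst b \<in> Arr C" "snd b \<in> Arr C"
    "Dom C (fst b) = Dom C (snd b)" and cod: "Cod C x = Dom C (fst b)"
    using x S_Arr spansD[OF b] unfolding vertical_def by auto
  have sp: "(?dx, x) \<in> spans C S" "(x, ?dx) \<in> spans C S" "(x, x) \<in> spans C S" "(?db, ?db) \<in> spans C S"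
    "(fst b, ?db) \<in> spans C S" "(?db, snd b) \<in> spans C S"
    using Ident_arr_span[OF xA] arr_Ident_span[OF xS] arr_arr_span[OF xS] Ident_span
      arr_Ident_span[OF Sb(1)] Ident_arr_span[OF Sb(3)] Sb by auto
  have iso: "iso D (AMap F (A.cls (?dx, x)))"
    using inv x(1) unfolding inverts_def Phi_a_def by auto
  have "AMap F (A.cls (x, ?dx)) \<cdot>\<^bsub>D\<^esub> AMap F (A.cls (?dx, x)) = Ident D (OMap F (Dom C x))"
    using F'(8)[of "A.cls (?dx, x)" "A.cls (x, ?dx)"] F'(4)[of "Dom C x"] sp xA
      A.cls_retract_right[OF order_refl xS] by simp
  \<comment> \<open>The class of \<open>(x, 1)\<close> is a left inverse of the class of
    \<open>(1, x)\<close> in \<open>Sect\<close>. Since \<open>F\<close> inverts the latter, the two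
    images are mutually inverse.\<close>
  then have "AMap F (A.cls (?dx, x)) \<cdot>\<^bsub>D\<^esub> AMap F (A.cls (x, ?dx)) = Ident D (OMap F (Cod C x))"
    using D.iso_left_inverse[OF iso, of "AMap F (A.cls (x, ?dx))"] F' sp xA by simp
  then have "AMap F (A.cls (x, x)) = Ident D (OMap F (Cod C x))"
    using F'(8)[of "A.cls (x, ?dx)" "A.cls (?dx, x)"] sp xA A.cls_retract_left[OF xS] by simp
  then have xx: "AMap F (A.cls (x, x)) = AMap F (A.cls (?db, ?db))"
    using F'(4)[of "Dom C (fst b)"] Sb cod by simp
  \<comment> \<open>Two instances are needed: \<open>x\<close> with the span \<open>a\<close>, and
    an identity with the span \<open>b\<close>. By \<open>xx\<close> their middle factors have the
    same image.\<close>
  have F_factor: "AMap F (A.cls c) = AMap F (A.cls (?db, snd b)) \<cdot>\<^bsub>D\<^esub>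
      (AMap F (A.cls (y, y)) \<cdot>\<^bsub>D\<^esub> AMap F (A.cls (fst b, ?db)))"
    if y: "y \<in> S" "vertical C y c b" and c: "c \<in> spans C S" for y c
  proof -
    note A.category_Quot [THEN category.Comp_in_Arr] A.category_Quot [THEN category.Dom_Comp]
      A.category_Quot [THEN category.Cod_Comp]
    moreover have "(y, y) \<in> spans C S" "Cod C y = Dom C (fst b)"
      using arr_arr_span[OF y(1)] y(2) unfolding vertical_def by auto
    ultimately show ?thesis
      using A.cls_factor[OF y c b] sp Sb by (simp add: F'(8))
  qed
  have "?db \<in> S"
    using Ident_S Sb by simp
  then show ?thesis
    using F_factor[OF xS x(3) a] F_factor[OF _ vertical_Ident[OF b] b] xx by simp
qed

text \<open>A functor inverting the given arrows is constant on the classes of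
  \<open>z_equiv C S T\<close>, so it descends to the quotient. It descends uniquely, because
  \<open>?L\<close> is the identity on objects and surjective on arrows.\<close>

lemma localization_z_equiv:
  assumes T: "S_star C S \<subseteq> T" "T \<subseteq> S" "pullback_stable C T"
  shows "is_localization TYPE(('p, 'q) cat) (Sect C S) (AMap (Phi_a C S) ` T)
    (span_quotient C S (z_equiv C S T)) (quotient_functor (z_equiv C S T))"
    (is "is_localization _ _ ?\<Sigma> ?Y ?L")
proof -
  interpret A: span_congruence C P S "a_equiv C S"
    by (rule span_congruence_a_equiv)
  interpret Z: span_congruence C P S "z_equiv C S T"
    by (rule span_congruence_z_equiv[OF T])
  have sub: "a_equiv C S \<subseteq> z_equiv C S T"
    by (rule a_equiv_subset_z_equiv[OF T(1)])
  have L: "is_functor A.Quot Z.Quot ?L"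
    using is_functor_quotient[OF span_congruence_a_equiv span_congruence_z_equiv[OF T] sub] .
  have AMap_L: "AMap ?L (A.cls a) = Z.cls a" if "a \<in> spans C S" for a
    using A.Image_cls[OF Z.equiv sub that] by (simp add: quotient_functor_def)
  have OMap_L: "OMap ?L A = A" for A
    by (simp add: quotient_functor_def)
  have Phi: "AMap (Phi_a C S) f = A.cls (Ident C (Dom C f), f)" for f
    by (simp add: Phi_a_def)
  have \<Sigma>: "?\<Sigma> \<subseteq> Arr A.Quot"
    using T(2) S_Arr Ident_arr_span by (auto simp: Phi)
  have "iso Z.Quot (AMap ?L (AMap (Phi_a C S) x))" if "x \<in> T" for x
  proof -
    have x: "x \<in> S" "x \<in> Arr C"
      using T(2) S_Arr that by auto
    let ?d = "Ident C (Dom C x)" and ?c = "Ident C (Cod C x)"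
    note sp = Ident_arr_span[OF x(2)] arr_Ident_span[OF x(1)]
    \<comment> \<open>For \<open>x\<close> in \<open>T\<close>, \<open>x\<close> itself is a
      vertical morphism from \<open>(x, x)\<close> to the identity span, so the class of
      \<open>(x, 1)\<close> becomes a two-sided inverse of the class of
      \<open>(1, x)\<close>.\<close>
    have "((x, x), (?c, ?c)) \<in> z_equiv C S T"
      using arr_arr_span[OF x(1)] Ident_span x that by (intro vertical_z_equiv) (auto simp: vertical_def)
    then have "Z.cls (x, x) = Z.cls (?c, ?c)"
      using Z.cls_eq_iff arr_arr_span[OF x(1)] Ident_span x by simp
    then show ?thesis
      unfolding iso_def Phi AMap_L[OF sp(1)]
      using sp x Z.cls_retract_left[OF x(1)] Z.cls_retract_right[OF sub x(1)]
      by (intro conjI bexI[of _ "Z.cls (x, ?d)"]) simp_all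
  qed
  then have inverts: "inverts Z.Quot ?L ?\<Sigma>"
    unfolding inverts_def by blast
  have "\<exists>G. is_functor Z.Quot D G \<and> functor_eq A.Quot (G \<circ>\<^sub>F ?L) F \<and>
      (\<forall>G'. is_functor Z.Quot D G' \<and> functor_eq A.Quot (G' \<circ>\<^sub>F ?L) F \<longrightarrow> functor_eq Z.Quot G' G)"
    if F: "is_functor A.Quot D F" and inv: "inverts D F ?\<Sigma>" for D :: "('p, 'q) cat" and F
  proof -
    note F' = functorD[OF F]
    \<comment> \<open>The kernel of \<open>F\<close> on spans is an equivalence relation. It
      contains the generators of \<open>z_equiv C S T\<close>, hence all of that relation.\<close>
    let ?K = "{(a, b). a \<in> spans C S \<and> b \<in> spans C S \<and> AMap F (A.cls a) = AMap F (A.cls b)}"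
    have "equiv (spans C S) ?K"
      by (auto intro!: equivI refl_onI symI transI)
    then have "z_equiv C S T \<subseteq> ?K"
      using functor_vertical_eq[OF F[folded Sect_def] inv _ T(2)] by (intro z_equiv_least) blast+
    then have K: "AMap F (A.cls a) = AMap F (A.cls b)" if "(a, b) \<in> z_equiv C S T" for a b
      using that by blast
    \<comment> \<open>The chosen representative is immaterial, as \<open>F\<close> takes the same
      value on \<open>z_equiv\<close>-related spans.\<close>
    define G where "G = \<lparr>OMap = OMap F, AMap = (\<lambda>X. AMap F (A.cls (SOME a. a \<in> X)))\<rparr>"
    have G: "AMap G (Z.cls a) = AMap F (A.cls a)" if "a \<in> spans C S" for a
    proof -
      have "(SOME b. b \<in> Z.cls a) \<in> Z.cls a"
        using Z.cls_self[OF that] by (rule someI)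
      then show ?thesis
        using K unfolding G_def by auto
    qed
    have OMap_G: "OMap G A = OMap F A" for A
      by (simp add: G_def)
    have "is_functor Z.Quot D G"
      unfolding is_functor_def
    proof (intro conjI ballI impI)
      fix X
      assume "X \<in> Arr Z.Quot"
      then show "AMap G X \<in> Arr D" "Dom D (AMap G X) = OMap G (Dom Z.Quot X)"
        "Cod D (AMap G X) = OMap G (Cod Z.Quot X)"
        using F'(5-7) by (auto elim!: Z.Quot_ArrE simp: G OMap_G)
    next
      fix X Y
      assume XY: "X \<in> Arr Z.Quot" "Y \<in> Arr Z.Quot" "Cod Z.Quot X = Dom Z.Quot Y"
      then obtain a b where ab: "a \<in> spans C S" "b \<in> spans C S" "X = Z.cls a" "Y = Z.cls b"
        by (metis Z.Quot_ArrE)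
      then obtain u where u: "is_hcomp C b a u"
        using XY hcomp_ex[of a b] by auto
      then show "AMap G (Y \<cdot>\<^bsub>Z.Quot\<^esub> X) = AMap G Y \<cdot>\<^bsub>D\<^esub> AMap G X"
        using ab XY hcompD(1)[OF u ab(1,2)] F'(8)[of "A.cls a" "A.cls b"]
        by (simp add: G Z.Quot_Comp A.Quot_Comp)
    next
      fix B
      assume "B \<in> Obj Z.Quot"
      then show "OMap G B \<in> Obj D" "AMap G (Ident Z.Quot B) = Ident D (OMap G B)"
        using F'(3,4)[of B] Ident_span[of B] by (simp_all add: G OMap_G)
    qed (use Z.category_Quot F'(2) in auto)
    moreover have "functor_eq A.Quot (G \<circ>\<^sub>F ?L) F"
      unfolding functor_eq_def functor_comp_def by (auto elim!: A.Quot_ArrE simp: AMap_L OMap_L G OMap_G)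
    moreover have "functor_eq Z.Quot G' G" if G': "functor_eq A.Quot (G' \<circ>\<^sub>F ?L) F" for G'
      unfolding functor_eq_def
    proof (intro conjI ballI)
      fix B
      assume "B \<in> Obj Z.Quot"
      then show "OMap G' B = OMap G B"
        using G' unfolding functor_eq_def functor_comp_def by (simp add: OMap_G OMap_L)
    next
      fix X
      assume "X \<in> Arr Z.Quot"
      then obtain a where a: "a \<in> spans C S" "X = Z.cls a"
        by (rule Z.Quot_ArrE)
      have "AMap G' (AMap ?L (A.cls a)) = AMap F (A.cls a)"
        using G' a(1) unfolding functor_eq_def functor_comp_def by simp
      then show "AMap G' X = AMap G X"
        using a by (simp add: AMap_L G)
    qed
    ultimately show ?thesis
      by blast
  qed
  then show ?thesis
    unfolding is_localization_def Sect_def using \<Sigma> L inverts by blast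
qed

end

section \<open>Uniqueness of the category of fractions\<close>

lemma localization_extend:
  assumes "is_localization TYPE(('r, 's) cat) X \<Sigma> Y L"
    and "is_functor X (D :: ('r, 's) cat) F" "inverts D F \<Sigma>"
  obtains G where "is_functor Y D G" "functor_eq X (G \<circ>\<^sub>F L) F"
  using assms unfolding is_localization_def by blast

lemma localization_extend_unique:
  assumes "is_localization TYPE(('r, 's) cat) X \<Sigma> Y L"
    and "is_functor X (D :: ('r, 's) cat) F" "inverts D F \<Sigma>"
    and "is_functor Y D G" "functor_eq X (G \<circ>\<^sub>F L) F" "is_functor Y D G'" "functor_eq X (G' \<circ>\<^sub>F L) F"
  shows "functor_eq Y G G'"
proof -
  obtain H where "\<forall>G'. is_functor Y D G' \<and> functor_eq X (G' \<circ>\<^sub>F L) F \<longrightarrow> functor_eq Y G' H"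
    using assms(1-3) unfolding is_localization_def by blast
  then show ?thesis
    using assms(4-7) unfolding functor_eq_def by metis
qed

lemma localizationD:
  assumes "is_localization T X \<Sigma> Y L"
  shows "\<Sigma> \<subseteq> Arr X" "is_functor X Y L" "inverts Y L \<Sigma>"
  using assms unfolding is_localization_def by blast+

text \<open>\<open>Y\<close> and \<open>W\<close> may have different types, so each universal
  property is assumed at both. The mixed instances give the functors \<open>K\<close> and
  \<open>M\<close>; the others show that their composites are identities.\<close>

lemma localization_unique:
  fixes Y :: "('r, 's) cat" and W :: "('p, 'q) cat"
  assumes Y: "is_localization TYPE(('r, 's) cat) X \<Sigma> Y L" "is_localization TYPE(('p, 'q) cat) X \<Sigma> Y L"
    and W: "is_localization TYPE(('r, 's) cat) X \<Sigma> W Q" "is_localization TYPE(('p, 'q) cat) X \<Sigma> W Q"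
  shows "\<exists>K. iso_functor Y W K \<and> functor_eq X (K \<circ>\<^sub>F L) Q"
proof -
  note L = localizationD(2,3)[OF Y(1)] and Q = localizationD(2,3)[OF W(1)]
  obtain K where K: "is_functor Y W K" "functor_eq X (K \<circ>\<^sub>F L) Q"
    by (rule localization_extend[OF Y(2) Q])
  obtain M where M: "is_functor W Y M" "functor_eq X (M \<circ>\<^sub>F Q) L"
    by (rule localization_extend[OF W(1) L])
  have id: "functor_eq X (functor_id \<circ>\<^sub>F L) L" "functor_eq X (functor_id \<circ>\<^sub>F Q) Q"
    by (simp_all add: functor_eq_def functor_id_def functor_comp_def)
  have "functor_eq X ((M \<circ>\<^sub>F K) \<circ>\<^sub>F L) L" "functor_eq X ((K \<circ>\<^sub>F M) \<circ>\<^sub>F Q) Q"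
    using K(2) M(2) by (simp_all add: functor_eq_def functor_comp_def)
  then have "functor_eq Y (M \<circ>\<^sub>F K) functor_id" "functor_eq W (K \<circ>\<^sub>F M) functor_id"
    using localization_extend_unique[OF Y(1) L is_functor_comp[OF K(1) M(1)] _
        is_functor_id[OF functorD(2)[OF L(1)]] id(1)]
      localization_extend_unique[OF W(2) Q is_functor_comp[OF M(1) K(1)] _
        is_functor_id[OF functorD(2)[OF Q(1)]] id(2)] by blast+
  then show ?thesis
    using K M unfolding iso_functor_def by blast
qed

lemma isomorphic_refl: "category X \<Longrightarrow> X \<cong>\<^sub>c X"
  using is_functor_id[of X] unfolding isomorphic_def iso_functor_def
  by (intro exI[of _ functor_id]) (auto simp: functor_eq_def functor_id_def functor_comp_def)


section \<open>The monic case\<close>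

context span_setting
begin

text \<open>Since \<open>S_star\<close> contains all isomorphisms, \<open>T\<close> is then exactly
  the class of isomorphisms, and isomorphism of spans is already an equivalence relation.\<close>

lemma z_equiv_iso:
  assumes "S_star C S \<subseteq> T" "T \<subseteq> Collect (iso C)"
  shows "z_equiv C S T = span_iso C S"
proof
  show "z_equiv C S T \<subseteq> span_iso C S"
    using assms(2) by (intro z_equiv_least equiv_span_iso) (auto intro: span_isoI)
  show "span_iso C S \<subseteq> z_equiv C S T"
    using assms(1) iso_S_star unfolding span_iso_def by (auto intro: vertical_z_equiv)
qed

text \<open>Cancelling \<open>v\<close> shows that the two cospans have the same commuting
  cones.\<close>

lemma is_pullback_monic:
  assumes ab: "is_pullback C f g p q" and v: "monic C v" "Dom C v = Cod C f"
  shows "is_pullback C (v \<cdot> f) (v \<cdot> g) p q"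
proof -
  note D = is_pullbackD[OF ab]
  have vA: "v \<in> Arr C"
    using v unfolding monic_def by blast
  show ?thesis
  proof (rule is_pullbackI)
    fix h k
    assume hk: "h \<in> Arr C" "k \<in> Arr C" "Dom C h = Dom C k" "Cod C h = Dom C (v \<cdot> f)"
      "Cod C k = Dom C (v \<cdot> g)" "(v \<cdot> f) \<cdot> h = (v \<cdot> g) \<cdot> k"
    have *: "Cod C h = Dom C f" "Cod C k = Dom C g"
      using hk D vA v(2) by simp_all
    have "v \<cdot> (f \<cdot> h) = v \<cdot> (g \<cdot> k)"
      using hk * D vA v(2) by simp
    then have "f \<cdot> h = g \<cdot> k"
      using v hk(1-3) * D unfolding monic_def by simp
    then show "\<exists>u. u \<in> Arr C \<and> Dom C u = Dom C h \<and> Cod C u = Dom C p \<and> p \<cdot> u = h \<and> q \<cdot> u = k"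
      using pullback_factor[OF ab hk(1-3) *] by blast
  next
    fix u w
    assume "u \<in> Arr C" "w \<in> Arr C" "Dom C u = Dom C w" "Cod C u = Dom C p" "Cod C w = Dom C p"
      "p \<cdot> u = p \<cdot> w" "q \<cdot> u = q \<cdot> w"
    then show "u = w"
      by (rule pullback_unique[OF ab])
  qed (use D v vA in simp_all)
qed

text \<open>For monic \<open>v\<close> the span \<open>a\<close> is a pullback of both cospans, so
  the conjugate is the comparison map between two pullbacks of \<open>d\<close>. A pullback of an
  isomorphism is again one.\<close>

lemma S_star_iso:
  assumes monic: "\<And>s. s \<in> S \<Longrightarrow> monic C s"
  shows "S_star C S \<subseteq> Collect (iso C)"
proof
  fix y
  assume "y \<in> S_star C S"
  then obtain v c d w h k where y: "v \<in> S" "is_conjugate C v c d w" "is_pullback C h w y k"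
    unfolding S_star_def by blast
  then obtain a b where ab: "is_pullback C (fst c) (snd c) (fst a) (snd a)"
    "is_pullback C (fst d) (snd d) (fst b) (snd b)" and w: "vertical C w a b" and v: "cospan_mor C v c d"
    unfolding is_conjugate_def is_pb_def by blast
  have "is_pullback C (fst d) (snd d) (fst a) (snd a)"
    using is_pullback_monic[OF ab(1) monic[OF y(1)]] v unfolding cospan_mor_def by simp
  then obtain x where x: "iso C x" "Dom C x = Dom C (fst a)" "Cod C x = Dom C (fst b)"
    "fst b \<cdot> x = fst a" "snd b \<cdot> x = snd a"
    by (rule is_pullback_iso_unique[OF _ ab(2)])
  have "x \<in> Arr C"
    using x(1) by (rule isoE)
  then have "w = x"
    using w x unfolding vertical_def by - (rule pullback_unique[OF ab(2)]; simp)
  then show "y \<in> Collect (iso C)"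
    using pullback_of_iso[OF y(3)] x(1) by simp
qed

text \<open>The isomorphisms are one of the classes intersected in \<open>S_circ\<close>. For the
  last closure condition, \<open>x \<cdot> q = p \<cdot> y\<close> lies in \<open>P\<close> because
  \<open>y\<close> is invertible, and \<open>iso_if_S_Comp_P\<close> applies.\<close>

lemma S_circ_iso:
  assumes monic: "\<And>s. s \<in> S \<Longrightarrow> monic C s"
  shows "S_circ C P S \<subseteq> Collect (iso C)"
  unfolding S_circ_def
proof (intro Inter_lower CollectI conjI ballI impI)
  show "S_star C S \<subseteq> Collect (iso C)"
    by (rule S_star_iso[OF monic])
  show "Collect (iso C) \<subseteq> S"
    using iso_S by auto
  show "pullback_stable C (Collect (iso C))"
    unfolding pullback_stable_def using pullback_of_iso by blast
  fix p q x y
  assume "p \<in> P" "q \<in> P" "x \<in> S" and y: "y \<in> Collect (iso C)"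
    and "Dom C q = Dom C y \<and> Cod C q = Dom C x \<and> Cod C y = Dom C p \<and> Cod C x = Cod C p \<and> x \<cdot> q = p \<cdot> y"
  then show "iso C x"
    using P_comp_iso[of p y] by (intro iso_if_S_Comp_P[of x q]) auto
qed

end

text \<open>The finer relation is absorbed by transitivity of the coarser one, and its reflexivity
  gives the converse. The maps agree on every set of spans, so the functors are equal as
  records.\<close>

lemma (in span_setting) Lambda_Gamma:
  "Lambda C P S \<circ>\<^sub>F Gamma C S = quotient_functor (zcirc_equiv C P S)"
proof -
  let ?R = "z_equiv C S (S_star C S)" and ?R' = "z_equiv C S (S_circ C P S)"
  have sub: "?R \<subseteq> ?R'"
    by (rule z_equiv_mono[OF S_star_subset_S_circ])
  have "?R' `` (?R `` X) = ?R' `` X" for X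
  proof (intro equalityI subsetI)
    fix b
    assume "b \<in> ?R' `` (?R `` X)"
    then obtain a c where "a \<in> X" "(a, c) \<in> ?R'" "(c, b) \<in> ?R'"
      using sub by blast
    then show "b \<in> ?R' `` X"
      using equiv_z_equiv[of "S_circ C P S"] by (auto simp: equiv_def dest: transD)
  next
    fix b
    assume "b \<in> ?R' `` X"
    then obtain a where a: "a \<in> X" "(a, b) \<in> ?R'"
      by blast
    then have "(a, a) \<in> ?R"
      using equiv_z_equiv[of "S_circ C P S"] equiv_z_equiv[of "S_star C S"]
      by (auto simp: equiv_def refl_on_def)
    then show "b \<in> ?R' `` (?R `` X)"
      using a by blast
  qed
  then show ?thesis
    by (simp add: functor_comp_def Lambda_def Gamma_def quotient_functor_def comp_def
        zstar_equiv_def zcirc_equiv_def)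
qed

lemma (in span_setting) localization_RaPar:
  "is_localization TYPE(('p, 'q) cat) (Sect C S) (AMap (Phi_a C S) ` S_circ C P S)
    (RaPar C P S) (Lambda C P S \<circ>\<^sub>F Gamma C S)"
  using localization_z_equiv[OF S_star_subset_S_circ S_circ_subset S_circ_pullback_stable]
  unfolding Lambda_Gamma RaPar_def zcirc_equiv_def .

text \<open>The middle conjunct expresses the isomorphism in the first claim: any other model
  \<open>W\<close> of the category of fractions is isomorphic to \<open>RaPar\<close>, compatibly
  with the localizing functors. The two hypotheses on \<open>W\<close> test it at its own type and
  at that of \<open>RaPar\<close>.\<close>

theorem corollary7:
  fixes C :: "('o, 'm) cat" and P S :: "'m set"
  assumes "span_setting C P S"
  shows
    "is_localization TYPE(('p, 'q) cat) (Sect C S) (AMap (Phi_a C S) ` S_circ C P S)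
        (RaPar C P S) (Lambda C P S \<circ>\<^sub>F Gamma C S) \<and>
     (\<forall>(W :: ('p, 'q) cat) Q.
        is_localization TYPE(('p, 'q) cat) (Sect C S) (AMap (Phi_a C S) ` S_circ C P S) W Q \<and>
        is_localization TYPE(('o, 'm span set) cat) (Sect C S) (AMap (Phi_a C S) ` S_circ C P S) W Q \<longrightarrow>
        (\<exists>K. iso_functor (RaPar C P S) W K \<and>
             functor_eq (Sect C S) (K \<circ>\<^sub>F (Lambda C P S \<circ>\<^sub>F Gamma C S)) Q)) \<and>
     ((\<forall>s\<in>S. monic C s) \<longrightarrow> RaPar C P S \<cong>\<^sub>c Par C S \<and> Par C S \<cong>\<^sub>c Span C S)"
proof -
  interpret span_setting C P S
    by (rule assms)
  have "RaPar C P S \<cong>\<^sub>c Par C S \<and> Par C S \<cong>\<^sub>c Span C S" if "\<forall>s\<in>S. monic C s"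
  proof -
    \<comment> \<open>Both relations reduce to isomorphism of spans, so the three categories are
      equal and the isomorphisms are identities.\<close>
    have "Par C S = Span C S" "RaPar C P S = Span C S"
      using that z_equiv_iso[OF order_refl S_star_iso] z_equiv_iso[OF S_star_subset_S_circ S_circ_iso]
      by (simp_all add: Par_def RaPar_def Span_def zstar_equiv_def zcirc_equiv_def)
    moreover have "category (Par C S)"
      using span_congruence.category_Quot[OF span_congruence_zstar]
      by (simp add: Par_def zstar_equiv_def)
    ultimately show ?thesis
      by (simp add: isomorphic_refl)
  qed
  then show ?thesis
    using localization_RaPar localization_unique[OF localization_RaPar localization_RaPar] by blast
qed

end
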